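(* Consider the following two discrete problems. (S) Second-order-in-time scheme: find $U_{h}\in Q_{h}^{p_t}(Q_T)$ such that $U_{h}(\cdot,0)=U_{0,h_x}$ in $\Omega$ and $$-(\partial_t U_h,\partial_t W_h)_{L^2(Q_T)}+(c^2\nabla_x U_h,\nabla_x\Pi_{h_t}W_h)_{L^2(Q_T)}=(F,\Pi_{h_t}W_h)_{L^2(Q_T)}+(V_{0,h_x},W_h(\cdot,0))_{L^2(\Omega)}$$ for all $W_h\in Q_{h,\bullet,0}^{p_t}(Q_T)$. (F) First-order-in-time scheme: find $\widetilde U_h,\widetilde V_h\in Q_h^{p_t}(Q_T)$ such that $\widetilde U_h(\cdot,0)=U_{0,h_x}$, $\widetilde V_h(\cdot,0)=V_{0,h_x}$ in $\Omega$, and $$(\partial_t\widetilde U_h,\chi_h)_{L^2(Q_T)}-(\widetilde V_h,\chi_h)_{L^2(Q_T)}=0,$$ $$(\partial_t\widetilde V_h,\lambda_h)_{L^2(Q_T)}+(c^2\nabla_x\widetilde U_h,\nabla_x\lambda_h)_{L^2(Q_T)}=(F,\lambda_h)_{L^2(Q_T)}$$ for all $\chi_h,\lambda_h\in\partial_tQ_h^{p_t}(Q_T)$. If $(\widetilde U_h,\widetilde V_h)$ is a solution of (F), then $U_h=\widetilde U_h$ is a solution of (S). Conversely, if $U_h$ is a solution of (S), then the pair $(\widetilde U_h,\widetilde V_h)$ with $\widetilde U_h=U_h$ and $\widetilde V_h\in Q_h^{p_t}(Q_T)$ such that $\Pi_{h_t}\widetilde V_h=\partial_tU_h$ and $\widetilde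 V_h(\cdot,0)=V_{0,h_x}$ is a solution of (F).
   Context: $\Omega\subset\mathbb R^d$ ($d\in\{1,2,3\}$) is a (bounded) polytopal Lipschitz domain, $T>0$, $Q_T=\Omega\times(0,T)$, $c\in C(\overline\Omega)$ with $c(x)\ge c_0>0$ for all $x\in\Omega$, and $U_0\in H^1_0(\Omega)$, $V_0\in L^2(\Omega)$, $F\in L^1(0,T;L^2(\Omega))$. For $F$, $(F,W)_{L^2(Q_T)}$ means $\int_0^T(F(\cdot,t),W(\cdot,t))_{L^2(\Omega)}\,dt$. $S_{h_x}(\Omega)\subset H^1_0(\Omega)$ is a space of piecewise polynomial functions of degree at most $p_x\ge1$ on a shape-regular conforming simplicial mesh of $\Omega$ with mesh size $h_x$. For nodes $0=t_0<t_1<\dots<t_{N_t}=T$ and an integer $p_t\ge1$, $S_{h_t}^{p_t}(0,T)$ is the space of continuous functions on $[0,T]$ that are polynomials of degree at most $p_t$ on each $[t_{i-1},t_i]$; $S_{h_t,\bullet,0}^{p_t}(0,T)$ is its subspace of functions vanishing at $t=T$; $\partial_tS_{h_t}^{p_t}(0,T)$ is the space of derivatives of its elements (discontinuous piecewise polynomials of degree at most $p_t-1$). Set $Q_h^{p_t}(Q_T)=S_{h_x}(\Omega)\otimes S_{h_t}^{p_t}(0,T)$, $\partial_tQ_h^{p_t}(Q_T)=S_{h_x}(\Omega)\otimes\partial_tS_{h_t}^{p_t}(0,T)$, $Q_{h,\bullet,0}^{p_t}(Q_T)=S_{h_x}(\Omega)\otimes S_{h_t,\bullet,0}^{p_t}(0,T)$.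 $\Pi_{h_t}:L^2(Q_T)\to L^2(\Omega)\otimes\partial_tS_{h_t}^{p_t}(0,T)$ is the $L^2$-orthogonal projection in time: $(\Pi_{h_t}U,\partial_tW)_{L^2(Q_T)}=(U,\partial_tW)_{L^2(Q_T)}$ for all $W\in L^2(\Omega)\otimes S_{h_t}^{p_t}(0,T)$. $U_{0,h_x},V_{0,h_x}\in S_{h_x}(\Omega)$ are defined by $(c^2\nabla_xU_{0,h_x},\nabla_xW)_{L^2(\Omega)}=(c^2\nabla_xU_0,\nabla_xW)_{L^2(\Omega)}$ and $(V_{0,h_x},W)_{L^2(\Omega)}=(V_0,W)_{L^2(\Omega)}$ for all $W\in S_{h_x}(\Omega)$. *)

theory Defs
  imports "HOL-Analysis.Analysis" "HOL-Computational_Algebra.Polynomial"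
begin

text \<open>
  Elements of Lebesgue and Sobolev spaces are represented by functions, and equality in such a
  space is equality almost everywhere.  Values of these functions outside the domain are
  irrelevant.  Space-time functions are written \<open>U x t\<close>.
\<close>

section \<open>Domains\<close>

text \<open>Locally the domain is the strict epigraph, in direction \<open>e\<close>, of a Lipschitz
  function on the hyperplane orthogonal to \<open>e\<close>.\<close>

definition lipschitz_domain :: "'a::euclidean_space set \<Rightarrow> bool" where
  "lipschitz_domain \<Omega> \<longleftrightarrow>
     open \<Omega> \<and> connected \<Omega> \<and> bounded \<Omega> \<and> \<Omega> \<noteq> {} \<and>
     (\<forall>x\<in>frontier \<Omega>. \<exists>e \<gamma> L r.
        norm e = 1 \<and> r > 0 \<and> L-lipschitz_on {z. z \<bullet> e = 0} \<gamma> \<and>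
        (\<forall>y\<in>ball x r. y \<in> \<Omega> \<longleftrightarrow> y \<bullet> e > \<gamma> (y - (y \<bullet> e) *\<^sub>R e)))"

definition polytopal :: "'a::euclidean_space set \<Rightarrow> bool" where
  "polytopal \<Omega> \<longleftrightarrow> (\<exists>\<P>. finite \<P> \<and> (\<forall>P\<in>\<P>. polytope P) \<and> closure \<Omega> = \<Union>\<P>)"

section \<open>Lebesgue and Sobolev spaces\<close>

definition L2 :: "(real^'n) set \<Rightarrow> (real^'n \<Rightarrow> 'b::euclidean_space) set" where
  "L2 \<Omega> = {f. f \<in> borel_measurable (lebesgue_on \<Omega>) \<and>
               integrable (lebesgue_on \<Omega>) (\<lambda>x. (norm (f x))\<^sup>2)}"

definition L2_inner :: "(real^'n) set \<Rightarrow> (real^'n \<Rightarrow> 'b::euclidean_space) \<Rightarrow> (real^'n \<Rightarrow> 'b) \<Rightarrow> real" where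
  "L2_inner \<Omega> f g = (LINT x|lebesgue_on \<Omega>. f x \<bullet> g x)"

definition L2_norm :: "(real^'n) set \<Rightarrow> (real^'n \<Rightarrow> 'b::euclidean_space) \<Rightarrow> real" where
  "L2_norm \<Omega> f = sqrt (L2_inner \<Omega> f f)"

definition partial :: "'n \<Rightarrow> (real^'n \<Rightarrow> real) \<Rightarrow> real^'n \<Rightarrow> real" where
  "partial i f x = frechet_derivative f (at x) (axis i 1)"

primrec continuously_differentiable :: "nat \<Rightarrow> (real^'n \<Rightarrow> real) \<Rightarrow> bool" where
  "continuously_differentiable 0 f \<longleftrightarrow> continuous_on UNIV f"
| "continuously_differentiable (Suc k) f \<longleftrightarrow>
     (\<forall>x. f differentiable (at x)) \<and> (\<forall>i. continuously_differentiable k (partial i f))"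

text \<open>\<open>C\<^sub>c\<^sup>\<infinity>(\<Omega>)\<close>, its elements being extended by zero to the whole space.\<close>

definition test_functions :: "(real^'n) set \<Rightarrow> (real^'n \<Rightarrow> real) set" where
  "test_functions \<Omega> = {\<phi>. (\<forall>k. continuously_differentiable k \<phi>) \<and>
     compact (closure {x. \<phi> x \<noteq> 0}) \<and> closure {x. \<phi> x \<noteq> 0} \<subseteq> \<Omega>}"

definition has_weak_gradient ::
    "(real^'n) set \<Rightarrow> (real^'n \<Rightarrow> real) \<Rightarrow> (real^'n \<Rightarrow> real^'n) \<Rightarrow> bool" where
  "has_weak_gradient \<Omega> u g \<longleftrightarrow> g \<in> L2 \<Omega> \<and>
     (\<forall>\<phi>\<in>test_functions \<Omega>. \<forall>i.
        L2_inner \<Omega> u (partial i \<phi>) = - L2_inner \<Omega> (\<lambda>x. g x $ i) \<phi>)"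

definition H1 :: "(real^'n) set \<Rightarrow> (real^'n \<Rightarrow> real) set" where
  "H1 \<Omega> = {u \<in> L2 \<Omega>. \<exists>g. has_weak_gradient \<Omega> u g}"

text \<open>For \<open>u \<in> H1 \<Omega>\<close> the weak gradient is determined up to a null set, so the choice below is
  a choice of representative.\<close>

definition grad :: "(real^'n) set \<Rightarrow> (real^'n \<Rightarrow> real) \<Rightarrow> real^'n \<Rightarrow> real^'n" where
  "grad \<Omega> u = (SOME g. has_weak_gradient \<Omega> u g)"

text \<open>Closure of the test functions in the \<open>H1\<close> norm.\<close>

definition H10 :: "(real^'n) set \<Rightarrow> (real^'n \<Rightarrow> real) set" where
  "H10 \<Omega> = {u \<in> H1 \<Omega>. \<exists>\<phi>. (\<forall>n. \<phi> n \<in> test_functions \<Omega>) \<and>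
     (\<lambda>n. L2_norm \<Omega> (\<lambda>x. \<phi> n x - u x)) \<longlonglongrightarrow> 0 \<and>
     (\<lambda>n. L2_norm \<Omega> (\<lambda>x. (\<chi> i. partial i (\<phi> n) x) - grad \<Omega> u x)) \<longlonglongrightarrow> 0}"

text \<open>The Bochner space \<open>L\<^sup>1(0,T; L\<^sup>2(\<Omega>))\<close>: almost everywhere in time, \<open>F\<close> is a limit in
  \<open>L\<^sup>2(\<Omega>)\<close> of simple functions, and its norm is integrable in time.\<close>

definition bochner_simple :: "(real^'n) set \<Rightarrow> real \<Rightarrow> (real^'n \<Rightarrow> real \<Rightarrow> real) \<Rightarrow> bool" where
  "bochner_simple \<Omega> T s \<longleftrightarrow>
     (\<exists>(m::nat) f A. (\<forall>k<m. f k \<in> L2 \<Omega> \<and> A k \<in> sets (lebesgue_on {0<..<T})) \<and>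
        s = (\<lambda>x t. \<Sum>k<m. f k x * indicator (A k) t))"

definition L1_L2 :: "(real^'n) set \<Rightarrow> real \<Rightarrow> (real^'n \<Rightarrow> real \<Rightarrow> real) set" where
  "L1_L2 \<Omega> T = {F.
     (AE t in lebesgue_on {0<..<T}. (\<lambda>x. F x t) \<in> L2 \<Omega>) \<and>
     (\<exists>s. (\<forall>n. bochner_simple \<Omega> T (s n)) \<and>
        (AE t in lebesgue_on {0<..<T}.
           (\<lambda>n. L2_norm \<Omega> (\<lambda>x. s n x t - F x t)) \<longlonglongrightarrow> 0)) \<and>
     integrable (lebesgue_on {0<..<T}) (\<lambda>t. L2_norm \<Omega> (\<lambda>x. F x t))}"

text \<open>The pairing on \<open>Q\<^sub>T = \<Omega> \<times> (0,T)\<close>; by Fubini it is the inner product of \<open>L\<^sup>2(Q\<^sub>T)\<close> when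
  both arguments are square integrable.\<close>

definition QT_inner :: "(real^'n) set \<Rightarrow> real \<Rightarrow>
    (real^'n \<Rightarrow> real \<Rightarrow> 'b::euclidean_space) \<Rightarrow> (real^'n \<Rightarrow> real \<Rightarrow> 'b) \<Rightarrow> real" where
  "QT_inner \<Omega> T U W =
     (LINT t|lebesgue_on {0<..<T}. L2_inner \<Omega> (\<lambda>x. U x t) (\<lambda>x. W x t))"

definition QT_eq :: "(real^'n) set \<Rightarrow> real \<Rightarrow>
    (real^'n \<Rightarrow> real \<Rightarrow> real) \<Rightarrow> (real^'n \<Rightarrow> real \<Rightarrow> real) \<Rightarrow> bool" where
  "QT_eq \<Omega> T U W \<longleftrightarrow>
     (AE t in lebesgue_on {0<..<T}. AE x in lebesgue_on \<Omega>. U x t = W x t)"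

definition gradx :: "(real^'n) set \<Rightarrow> (real^'n \<Rightarrow> real \<Rightarrow> real) \<Rightarrow> real^'n \<Rightarrow> real \<Rightarrow> real^'n" where
  "gradx \<Omega> U x t = grad \<Omega> (\<lambda>y. U y t) x"

text \<open>Used for functions that are piecewise polynomial in time; the value at the (finitely many)
  nodes, where the derivative need not exist, is immaterial.\<close>

definition dt :: "(real^'n \<Rightarrow> real \<Rightarrow> real) \<Rightarrow> real^'n \<Rightarrow> real \<Rightarrow> real" where
  "dt U x t = deriv (U x) t"

section \<open>Finite element spaces in space\<close>

text \<open>\<^const>\<open>triangulation\<close> contains conformity: two cells meet in a common (possibly empty) face.\<close>

definition simplicial_mesh :: "(real^'n) set \<Rightarrow> (real^'n) set set \<Rightarrow> bool" where
  "simplicial_mesh \<Omega> \<K> \<longleftrightarrow>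
     triangulation \<K> \<and> (\<forall>K\<in>\<K>. int CARD('n) simplex K) \<and> \<Union>\<K> = closure \<Omega>"

definition mesh_size :: "(real^'n) set set \<Rightarrow> real" where
  "mesh_size \<K> = Max (diameter ` \<K>)"

definition inball_diameter :: "(real^'n) set \<Rightarrow> real" where
  "inball_diameter K = Sup {2 * r |r z. 0 \<le> r \<and> cball z r \<subseteq> K}"

definition shape_regular :: "real \<Rightarrow> (real^'n) set set \<Rightarrow> bool" where
  "shape_regular \<sigma> \<K> \<longleftrightarrow> (\<forall>K\<in>\<K>. diameter K \<le> \<sigma> * inball_diameter K)"

text \<open>Polynomials of total degree at most \<open>p\<close>; \<open>\<alpha>\<close> ranges over multi-indices.\<close>

definition polynomial_deg_le :: "nat \<Rightarrow> (real^'n \<Rightarrow> real) \<Rightarrow> bool" where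
  "polynomial_deg_le p f \<longleftrightarrow> (\<exists>a. \<forall>x.
     f x = (\<Sum>\<alpha>\<in>{\<alpha>::'n \<Rightarrow> nat. (\<Sum>i\<in>UNIV. \<alpha> i) \<le> p}. a \<alpha> * (\<Prod>i\<in>UNIV. x $ i ^ \<alpha> i)))"

text \<open>Piecewise polynomials in \<open>H10 \<Omega>\<close> have a continuous representative; requiring a polynomial on
  each closed cell selects it.\<close>

definition piecewise_polynomial_H10 ::
    "(real^'n) set \<Rightarrow> (real^'n) set set \<Rightarrow> nat \<Rightarrow> (real^'n \<Rightarrow> real) set" where
  "piecewise_polynomial_H10 \<Omega> \<K> p =
     {v \<in> H10 \<Omega>. \<forall>K\<in>\<K>. \<exists>f. polynomial_deg_le p f \<and> (\<forall>x\<in>K. v x = f x)}"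

definition linear_function_space :: "('a \<Rightarrow> real) set \<Rightarrow> bool" where
  "linear_function_space S \<longleftrightarrow>
     (\<lambda>x. 0) \<in> S \<and> (\<forall>u\<in>S. \<forall>v\<in>S. (\<lambda>x. u x + v x) \<in> S) \<and> (\<forall>a. \<forall>u\<in>S. (\<lambda>x. a * u x) \<in> S)"

section \<open>Finite element spaces in time\<close>

definition time_partition :: "(nat \<Rightarrow> real) \<Rightarrow> nat \<Rightarrow> real \<Rightarrow> bool" where
  "time_partition \<tau> N T \<longleftrightarrow> \<tau> 0 = 0 \<and> \<tau> N = T \<and> (\<forall>i<N. \<tau> i < \<tau> (Suc i))"

definition S_time :: "(nat \<Rightarrow> real) \<Rightarrow> nat \<Rightarrow> nat \<Rightarrow> (real \<Rightarrow> real) set" where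
  "S_time \<tau> N p = {\<psi>. continuous_on {\<tau> 0..\<tau> N} \<psi> \<and>
     (\<forall>i<N. \<exists>q. degree q \<le> p \<and> (\<forall>s\<in>{\<tau> i..\<tau> (Suc i)}. \<psi> s = poly q s))}"

definition S_time_end0 :: "(nat \<Rightarrow> real) \<Rightarrow> nat \<Rightarrow> nat \<Rightarrow> (real \<Rightarrow> real) set" where
  "S_time_end0 \<tau> N p = {\<psi> \<in> S_time \<tau> N p. \<psi> (\<tau> N) = 0}"

text \<open>The values at the nodes are left unspecified.\<close>

definition dS_time :: "(nat \<Rightarrow> real) \<Rightarrow> nat \<Rightarrow> nat \<Rightarrow> (real \<Rightarrow> real) set" where
  "dS_time \<tau> N p = {\<xi>. \<exists>\<psi>\<in>S_time \<tau> N p.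
     \<forall>i<N. \<forall>s\<in>{\<tau> i<..<\<tau> (Suc i)}. \<xi> s = deriv \<psi> s}"

definition tensor :: "('a \<Rightarrow> real) set \<Rightarrow> ('b \<Rightarrow> real) set \<Rightarrow> ('a \<Rightarrow> 'b \<Rightarrow> real) set" where
  "tensor A B = {U. \<exists>(m::nat) v \<psi>. (\<forall>k<m. v k \<in> A \<and> \<psi> k \<in> B) \<and>
     U = (\<lambda>x t. \<Sum>k<m. v k x * \<psi> k t)}"

section \<open>Projection in time and the two schemes\<close>

definition is_time_projection :: "(real^'n) set \<Rightarrow> real \<Rightarrow> (nat \<Rightarrow> real) \<Rightarrow> nat \<Rightarrow> nat \<Rightarrow>
    (real^'n \<Rightarrow> real \<Rightarrow> real) \<Rightarrow> (real^'n \<Rightarrow> real \<Rightarrow> real) \<Rightarrow> bool" where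
  "is_time_projection \<Omega> T \<tau> N p U P \<longleftrightarrow>
     P \<in> tensor (L2 \<Omega>) (dS_time \<tau> N p) \<and>
     (\<forall>W\<in>tensor (L2 \<Omega>) (S_time \<tau> N p). QT_inner \<Omega> T P (dt W) = QT_inner \<Omega> T U (dt W))"

text \<open>As for \<^const>\<open>grad\<close>, this picks a representative of a class that is unique up to null sets.\<close>

definition time_projection :: "(real^'n) set \<Rightarrow> real \<Rightarrow> (nat \<Rightarrow> real) \<Rightarrow> nat \<Rightarrow> nat \<Rightarrow>
    (real^'n \<Rightarrow> real \<Rightarrow> real) \<Rightarrow> (real^'n \<Rightarrow> real \<Rightarrow> real)" where
  "time_projection \<Omega> T \<tau> N p U = (SOME P. is_time_projection \<Omega> T \<tau> N p U P)"

definition stiffness :: "(real^'n) set \<Rightarrow> real \<Rightarrow> (real^'n \<Rightarrow> real) \<Rightarrow>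
    (real^'n \<Rightarrow> real \<Rightarrow> real) \<Rightarrow> (real^'n \<Rightarrow> real \<Rightarrow> real) \<Rightarrow> real" where
  "stiffness \<Omega> T c U W = QT_inner \<Omega> T (\<lambda>x t. (c x)\<^sup>2 *\<^sub>R gradx \<Omega> U x t) (gradx \<Omega> W)"

definition second_order_solution :: "(real^'n) set \<Rightarrow> real \<Rightarrow> (real^'n \<Rightarrow> real) \<Rightarrow>
    (real^'n \<Rightarrow> real \<Rightarrow> real) \<Rightarrow> (real^'n \<Rightarrow> real) set \<Rightarrow> (nat \<Rightarrow> real) \<Rightarrow> nat \<Rightarrow> nat \<Rightarrow>
    (real^'n \<Rightarrow> real) \<Rightarrow> (real^'n \<Rightarrow> real) \<Rightarrow> (real^'n \<Rightarrow> real \<Rightarrow> real) \<Rightarrow> bool" where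
  "second_order_solution \<Omega> T c F S \<tau> N p U0h V0h U \<longleftrightarrow>
     U \<in> tensor S (S_time \<tau> N p) \<and>
     (\<forall>x\<in>\<Omega>. U x 0 = U0h x) \<and>
     (\<forall>W\<in>tensor S (S_time_end0 \<tau> N p).
        - QT_inner \<Omega> T (dt U) (dt W) + stiffness \<Omega> T c U (time_projection \<Omega> T \<tau> N p W)
        = QT_inner \<Omega> T F (time_projection \<Omega> T \<tau> N p W) + L2_inner \<Omega> V0h (\<lambda>x. W x 0))"

definition first_order_solution :: "(real^'n) set \<Rightarrow> real \<Rightarrow> (real^'n \<Rightarrow> real) \<Rightarrow>
    (real^'n \<Rightarrow> real \<Rightarrow> real) \<Rightarrow> (real^'n \<Rightarrow> real) set \<Rightarrow> (nat \<Rightarrow> real) \<Rightarrow> nat \<Rightarrow> nat \<Rightarrow>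
    (real^'n \<Rightarrow> real) \<Rightarrow> (real^'n \<Rightarrow> real) \<Rightarrow>
    (real^'n \<Rightarrow> real \<Rightarrow> real) \<Rightarrow> (real^'n \<Rightarrow> real \<Rightarrow> real) \<Rightarrow> bool" where
  "first_order_solution \<Omega> T c F S \<tau> N p U0h V0h U V \<longleftrightarrow>
     U \<in> tensor S (S_time \<tau> N p) \<and> V \<in> tensor S (S_time \<tau> N p) \<and>
     (\<forall>x\<in>\<Omega>. U x 0 = U0h x) \<and> (\<forall>x\<in>\<Omega>. V x 0 = V0h x) \<and>
     (\<forall>\<xi>\<in>tensor S (dS_time \<tau> N p).
        QT_inner \<Omega> T (dt U) \<xi> - QT_inner \<Omega> T V \<xi> = 0) \<and>
     (\<forall>\<Lambda>\<in>tensor S (dS_time \<tau> N p).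
        QT_inner \<Omega> T (dt V) \<Lambda> + stiffness \<Omega> T c U \<Lambda> = QT_inner \<Omega> T F \<Lambda>)"

end

theory Submission
  imports Defs
begin

text \<open>
  The link between the two schemes is the orthogonal projection in time \<open>\<Pi>\<close> onto discontinuous
  piecewise polynomials.  If \<open>W\<close> is a test function of the second-order scheme and \<open>\<Lambda> = \<Pi> W\<close>, then,
  \<open>\<partial>\<^sub>tV\<close> being such a piecewise polynomial itself, integration by parts in time together with
  \<open>W(T) = 0\<close> and \<open>V(0) = V\<^sub>0\<close> gives
  \<open>(\<partial>\<^sub>tV, \<Lambda>) = (\<partial>\<^sub>tV, W) = - (V, \<partial>\<^sub>tW) - (V\<^sub>0, W(0))\<close>
  (\<open>velocity_inner_projection\<close>).  The first equation of the first-order scheme says exactly that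
  \<open>\<Pi> V = \<partial>\<^sub>tU\<close>, so that \<open>(V, \<partial>\<^sub>tW) = (\<partial>\<^sub>tU, \<partial>\<^sub>tW)\<close>.  Hence the second equation of the first-order scheme,
  tested with \<open>\<Lambda>\<close>, is the second-order scheme tested with \<open>W\<close>.

  Going from the first-order to the second-order scheme this requires only that \<open>\<Pi> W\<close> exists
  within the same tensor product space.  The converse requires that every \<open>\<Lambda>\<close> is \<open>\<Pi> W\<close> for some
  \<open>W\<close> vanishing at \<open>T\<close>, and the existence of \<open>V\<close> that every \<open>\<partial>\<^sub>tU\<close> is \<open>\<Pi> V\<close> for some \<open>V\<close> with prescribed
  value at \<open>0\<close>.  Both follow from a computation on one cell \<open>[a,b]\<close>: a polynomial of degree at most
  \<open>p\<close> is fixed by its projection onto degree below \<open>p\<close> up to a multiple of the Legendre polynomial of degree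
  \<open>p\<close>, which has no zero at \<open>a\<close> or \<open>b\<close>, so that one endpoint value can be prescribed
  (\<open>exists_poly_prescribed_projection\<close>).  Continuity then fixes the cells one after the other, forwards from \<open>0\<close>
  or backwards from \<open>T\<close> (\<open>glue_cells\<close>).

  The choice of representatives is harmless: two projections of the same function agree almost
  everywhere (\<open>is_time_projection_unique\<close>), and the chosen weak gradient depends only on the class
  of a function (\<open>grad_cong_AE\<close>).  Hence the pairing with \<open>F\<close> and the stiffness form take the same
  values at all projections of \<open>W\<close>.
\<close>

section \<open>Projection of polynomials on one cell\<close>

text \<open>Unlike a bound on \<^const>\<open>degree\<close>, this makes sense for \<open>d = 0\<close>, where only the zero
  polynomial is left.\<close>

definition deg_less :: "real poly \<Rightarrow> nat \<Rightarrow> bool" where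
  "deg_less s d \<longleftrightarrow> (\<forall>i\<ge>d. coeff s i = 0)"

lemma deg_less_Suc_iff: "deg_less s (Suc d) \<longleftrightarrow> degree s \<le> d"
  unfolding deg_less_def by (auto simp: Suc_le_eq intro: degree_le coeff_eq_0)

lemma deg_less_pderiv: "degree q \<le> p \<Longrightarrow> deg_less (pderiv q) p"
  unfolding deg_less_def by (auto simp: coeff_pderiv coeff_eq_0)

lemma deg_less_add: "deg_less r d \<Longrightarrow> deg_less s d \<Longrightarrow> deg_less (r + s) d"
  and deg_less_smult: "deg_less s d \<Longrightarrow> deg_less (smult a s) d"
  and deg_less_mono: "deg_less s d \<Longrightarrow> d \<le> e \<Longrightarrow> deg_less s e"
  by (auto simp: deg_less_def)

lemma exists_antiderivative:
  assumes "deg_less r p"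
  shows "\<exists>q. degree q \<le> p \<and> pderiv q = r \<and> poly q z = \<alpha>"
proof -
  define q0 where "q0 = pCons 0 (\<Sum>i<p. monom (coeff r i / real (Suc i)) i)"
  have c: "coeff q0 (Suc i) = (if i < p then coeff r i / real (Suc i) else 0)" for i
    by (simp add: q0_def coeff_sum)
  define q where "q = q0 + [:\<alpha> - poly q0 z:]"
  have d: "pderiv q = r"
    using assms by (intro poly_eqI) (auto simp: q_def pderiv_add coeff_pderiv c deg_less_def pderiv_pCons)
  have "coeff q i = 0" if "i > p" for i
    using that by (cases i) (auto simp: q_def c)
  then have "degree q \<le> p" by (simp add: degree_le)
  moreover have "poly q z = \<alpha>" by (simp add: q_def)
  ultimately show ?thesis using d by blast
qed

lemma poly_has_integral: "(poly q has_integral integral {a..b} (poly q)) {a..b::real}"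
  by (intro integrable_integral integrable_continuous_real continuous_intros)

lemma integral_poly_add: "integral {a..b::real} (poly (p + q)) = integral {a..b} (poly p) + integral {a..b} (poly q)"
  and integral_poly_smult: "integral {a..b} (poly (smult c q)) = c * integral {a..b} (poly q)"
  using has_integral_add[OF poly_has_integral[of p a b] poly_has_integral[of q a b]]
    has_integral_mult_right[OF poly_has_integral[of q a b], of c]
  by (auto intro!: integral_unique simp: fun_eq_iff cong: has_integral_cong)

lemma integral_poly_pos:
  fixes a b :: real
  assumes "a < b" "q \<noteq> 0" "\<And>x. x \<in> {a..b} \<Longrightarrow> poly q x \<ge> 0"
  shows "integral {a..b} (poly q) > 0"
proof -
  have "integral {a..b} (poly q) \<ge> 0"
    by (rule integral_nonneg) (use assms has_integral_integrable[OF poly_has_integral] in auto)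
  moreover have "integral {a..b} (poly q) \<noteq> 0"
  proof
    assume "integral {a..b} (poly q) = 0"
    moreover have "continuous_on {a..b} (poly q)" by (intro continuous_intros)
    ultimately have "\<forall>x\<in>{a..b}. poly q x = 0"
      using integral_eq_0_iff[of a b "poly q"] assms by simp
    then have "{a..b} \<subseteq> {x. poly q x = 0}" by auto
    moreover have "infinite {a..b}" using assms by (simp add: infinite_Icc)
    ultimately show False using poly_roots_finite[OF assms(2)] finite_subset by blast
  qed
  ultimately show ?thesis by simp
qed

definition orthogonal_below :: "real \<Rightarrow> real \<Rightarrow> nat \<Rightarrow> real poly \<Rightarrow> bool" where
  "orthogonal_below a b d q \<longleftrightarrow> (\<forall>s. deg_less s d \<longrightarrow> integral {a..b} (poly (q * s)) = 0)"

text \<open>Gram--Schmidt: the part of \<open>x\<^sup>d\<close> orthogonal to the lower degrees supplies the one new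
  direction when the degree bound is raised from \<open>d\<close> to \<open>d + 1\<close>.\<close>

lemma exists_poly_projection:
  assumes "a < b"
  shows "\<exists>r. deg_less r d \<and> orthogonal_below a b d (q - r)"
proof (induction d arbitrary: q)
  case 0
  have "deg_less s 0 \<longleftrightarrow> s = 0" for s by (auto simp: deg_less_def poly_eq_iff)
  moreover have "poly (0 :: real poly) = (\<lambda>x. 0)" by auto
  ultimately show ?case by (intro exI[of _ 0]) (simp add: orthogonal_below_def)
next
  case (Suc d)
  obtain r where r: "deg_less r d" "orthogonal_below a b d (q - r)" using Suc by blast
  obtain m where m: "deg_less m d" "orthogonal_below a b d (monom 1 d - m)" using Suc by blast
  define e where "e = monom 1 d - m"
  have e0: "e \<noteq> 0" using m(1) by (auto simp: e_def deg_less_def poly_eq_iff)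
  have "integral {a..b} (poly (e * e)) > 0"
    by (rule integral_poly_pos) (use assms e0 in auto)
  then have ee: "integral {a..b} (poly (e * e)) \<noteq> 0" by simp
  have eS: "deg_less e (Suc d)" using m(1) by (auto simp: e_def deg_less_def)
  define k where "k = integral {a..b} (poly ((q - r) * e)) / integral {a..b} (poly (e * e))"
  define r' where "r' = r + smult k e"
  have "deg_less r' (Suc d)" unfolding r'_def
    by (intro deg_less_add deg_less_smult eS deg_less_mono[OF r(1)]) simp
  moreover have "integral {a..b} (poly ((q - r') * s)) = 0" if s: "deg_less s (Suc d)" for s
  proof -
    define s' where "s' = s - smult (coeff s d) e"
    have s': "deg_less s' d"
      unfolding deg_less_def
    proof (intro allI impI)
      fix i assume "i \<ge> d"
      then show "coeff s' i = 0"
        using s m(1) by (cases "i = d") (auto simp: s'_def e_def deg_less_def)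
    qed
    have eq: "(q - r') * s = ((q - r) * s' + smult (- k) (e * s'))
        + (smult (coeff s d) ((q - r) * e) + smult (- k * coeff s d) (e * e))"
      by (simp add: r'_def s'_def algebra_simps smult_add_right smult_diff_right)
    have "integral {a..b} (poly ((q - r) * s')) = 0" "integral {a..b} (poly (e * s')) = 0"
      using r(2) m(2) s' unfolding orthogonal_below_def e_def by blast+
    then show ?thesis unfolding eq integral_poly_add integral_poly_smult
      using ee by (simp add: k_def)
  qed
  ultimately show ?case unfolding orthogonal_below_def by blast
qed

text \<open>The remainder \<open>e\<close> that projecting \<open>x\<^sup>d\<close> leaves is, up to scaling, the Legendre polynomial of the cell, and adding a multiple
  of it to \<open>r\<close> does not affect the projection.  If \<open>e\<close> vanished at an endpoint \<open>z\<close>, then \<open>e = (x - z) s\<close> with \<open>s\<close>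
  of degree below \<open>d\<close>, so \<open>\<integral> (x - z) s\<^sup>2 = 0\<close>, although \<open>x - z\<close> has a fixed sign on the cell.\<close>

lemma exists_poly_prescribed_projection:
  assumes ab: "a < b" and r: "deg_less r d" and z: "z = a \<or> z = b"
  shows "\<exists>q. degree q \<le> d \<and> poly q z = \<alpha> \<and> orthogonal_below a b d (q - r)"
proof -
  obtain m where m: "deg_less m d" "orthogonal_below a b d (monom 1 d - m)"
    using exists_poly_projection[OF ab] by blast
  define e where "e = monom 1 d - m"
  have e0: "e \<noteq> 0" and eS: "deg_less e (Suc d)"
    using m(1) by (auto simp: e_def deg_less_def poly_eq_iff)
  have ez: "poly e z \<noteq> 0"
  proof
    assume "poly e z = 0"
    then obtain s where s: "e = [:- z, 1:] * s" by (auto simp: poly_eq_0_iff_dvd elim: dvdE)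
    have "s \<noteq> 0" using s e0 by auto
    then have "degree e = Suc (degree s)"
      unfolding s by (subst degree_mult_eq) auto
    then have "degree s < d" using eS by (simp add: deg_less_Suc_iff)
    then have "deg_less s d" by (auto simp: deg_less_def coeff_eq_0)
    then have int0: "integral {a..b} (poly (e * s)) = 0"
      using m(2) by (auto simp: orthogonal_below_def e_def)
    have nz: "smult k (e * s) \<noteq> 0" if "k \<noteq> 0" for k
      using that e0 \<open>s \<noteq> 0\<close> by simp
    have form: "poly (smult k (e * s)) x = k * (x - z) * (poly s x)\<^sup>2" for k x
      by (simp add: s power2_eq_square algebra_simps)
    \<comment> \<open>\<open>k\<close> is the sign of \<open>x - z\<close> on the cell.\<close>
    obtain k :: real where k: "k \<noteq> 0" "\<And>x. x \<in> {a..b} \<Longrightarrow> 0 \<le> k * (x - z)"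
      using z by (elim disjE) (force intro: that[of 1], force intro: that[of "-1"])
    have "poly (smult k (e * s)) x \<ge> 0" if "x \<in> {a..b}" for x
      unfolding form using k(2)[OF that] by simp
    then have "integral {a..b} (poly (smult k (e * s))) > 0"
      by (rule integral_poly_pos[OF ab nz[OF k(1)]])
    then show False using int0 integral_poly_smult[of a b k "e * s"] by simp
  qed
  define k where "k = (\<alpha> - poly r z) / poly e z"
  define q where "q = r + smult k e"
  have "deg_less q (Suc d)"
    unfolding q_def by (intro deg_less_add deg_less_smult eS deg_less_mono[OF r]) simp
  moreover have "poly q z = \<alpha>" using ez by (simp add: q_def k_def)
  moreover have "orthogonal_below a b d (q - r)"
    using m(2) by (simp add: orthogonal_below_def q_def flip: e_def) (simp add: integral_poly_smult)
  ultimately show ?thesis by (auto simp: deg_less_Suc_iff)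
qed

section \<open>Gluing polynomials into continuous splines\<close>

lemma time_partition_mono:
  assumes "time_partition \<tau> N T" "i \<le> j" "j \<le> N"
  shows "\<tau> i \<le> \<tau> j"
  using assms(2,3)
proof (induction rule: dec_induct)
  case (step n)
  have "\<tau> n < \<tau> (Suc n)" using assms(1) step.prems by (simp add: time_partition_def)
  then show ?case using step by simp
qed simp

lemma time_partition_Suc:
  "time_partition \<tau> (Suc N) T \<Longrightarrow> time_partition \<tau> N (\<tau> N) \<and> \<tau> N < \<tau> (Suc N)"
  by (auto simp: time_partition_def)

lemma S_time_extend:
  assumes part: "time_partition \<tau> (Suc N) T" and \<psi>: "\<psi> \<in> S_time \<tau> N p"
    and q: "degree q \<le> p" "poly q (\<tau> N) = \<psi> (\<tau> N)"
  shows "(\<lambda>s. if s \<le> \<tau> N then \<psi> s else poly q s) \<in> S_time \<tau> (Suc N) p"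
proof -
  let ?\<psi> = "\<lambda>s. if s \<le> \<tau> N then \<psi> s else poly q s"
  have le: "\<tau> 0 \<le> \<tau> N" "\<tau> N < \<tau> (Suc N)"
    using time_partition_mono[of \<tau> N _ 0 N] time_partition_Suc[OF part] by auto
  have *: "{\<tau> 0..\<tau> (Suc N)} = {\<tau> 0..\<tau> N} \<union> {\<tau> N..\<tau> (Suc N)}" using le by auto
  have "continuous_on {\<tau> 0..\<tau> (Suc N)} ?\<psi>" unfolding *
    by (rule continuous_on_If) (use \<psi> q le in \<open>auto simp: S_time_def intro!: continuous_intros\<close>)
  moreover have "\<exists>q. degree q \<le> p \<and> (\<forall>s\<in>{\<tau> i..\<tau> (Suc i)}. ?\<psi> s = poly q s)" if "i < Suc N" for i
  proof (cases "i = N")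
    case True
    then show ?thesis using q by (intro exI[of _ q]) auto
  next
    case False
    then have i: "i < N" using that by simp
    then obtain r where "degree r \<le> p" "\<forall>s\<in>{\<tau> i..\<tau> (Suc i)}. \<psi> s = poly r s"
      using \<psi> by (auto simp: S_time_def)
    moreover have "\<tau> (Suc i) \<le> \<tau> N"
      using time_partition_mono[of \<tau> N _ "Suc i" N] time_partition_Suc[OF part] i by auto
    ultimately show ?thesis by (intro exI[of _ r]) auto
  qed
  ultimately show ?thesis by (simp add: S_time_def)
qed

text \<open>If on every cell an admissible polynomial (one satisfying \<open>C i\<close>) can be found for each prescribed left (\<open>fwd\<close>) or
  right (\<open>\<not> fwd\<close>) endpoint value, then there is a continuous spline with admissible pieces and
  prescribed first or last value.  One induction, adding the last cell, serves both directions: forwards, the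
  initial part is built first and the last piece continues it; backwards, the last piece is chosen first, and its
  value at the inner node becomes the prescribed final value of the initial part.\<close>

lemma glue_cells:
  assumes part: "time_partition \<tau> N T"
    and cells: "\<And>i \<alpha>. i < N \<Longrightarrow> \<exists>q. degree q \<le> p \<and> C i q \<and> poly q (\<tau> (if fwd then i else Suc i)) = \<alpha>"
  shows "\<exists>\<psi>\<in>S_time \<tau> N p. \<psi> (\<tau> (if fwd then 0 else N)) = \<alpha> \<and>
           (\<forall>i<N. \<exists>q. C i q \<and> (\<forall>s\<in>{\<tau> i..\<tau> (Suc i)}. \<psi> s = poly q s))"
  using assms
proof (induction N arbitrary: T \<alpha>)
  case 0
  show ?case by (intro bexI[of _ "\<lambda>s. \<alpha>"]) (auto simp: S_time_def)
next
  case (Suc N)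
  note part = time_partition_Suc[OF Suc.prems(1)]
  have IH: "\<exists>\<psi>\<in>S_time \<tau> N p. \<psi> (\<tau> (if fwd then 0 else N)) = \<beta> \<and>
           (\<forall>i<N. \<exists>q. C i q \<and> (\<forall>s\<in>{\<tau> i..\<tau> (Suc i)}. \<psi> s = poly q s))" for \<beta>
    using Suc.IH[of "\<tau> N"] part Suc.prems(2) by auto
  have "\<exists>\<psi> q. \<psi> \<in> S_time \<tau> N p \<and> degree q \<le> p \<and> C N q \<and> poly q (\<tau> N) = \<psi> (\<tau> N) \<and>
      (if fwd then \<psi> (\<tau> 0) = \<alpha> else poly q (\<tau> (Suc N)) = \<alpha>) \<and>
      (\<forall>i<N. \<exists>q. C i q \<and> (\<forall>s\<in>{\<tau> i..\<tau> (Suc i)}. \<psi> s = poly q s))"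
  proof (cases fwd)
    case True
    obtain \<psi> where \<psi>: "\<psi> \<in> S_time \<tau> N p" "\<psi> (\<tau> 0) = \<alpha>"
        "\<forall>i<N. \<exists>q. C i q \<and> (\<forall>s\<in>{\<tau> i..\<tau> (Suc i)}. \<psi> s = poly q s)"
      using IH[of \<alpha>] True by auto
    moreover obtain q where "degree q \<le> p" "C N q" "poly q (\<tau> N) = \<psi> (\<tau> N)"
      using Suc.prems(2)[of N "\<psi> (\<tau> N)"] True by auto
    ultimately show ?thesis using True by (intro exI[of _ \<psi>] exI[of _ q]) simp
  next
    case False
    obtain q where q: "degree q \<le> p" "C N q" "poly q (\<tau> (Suc N)) = \<alpha>"
      using Suc.prems(2)[of N \<alpha>] False by auto
    moreover obtain \<psi> where "\<psi> \<in> S_time \<tau> N p" "\<psi> (\<tau> N) = poly q (\<tau> N)"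
        "\<forall>i<N. \<exists>q. C i q \<and> (\<forall>s\<in>{\<tau> i..\<tau> (Suc i)}. \<psi> s = poly q s)"
      using IH[of "poly q (\<tau> N)"] False by auto
    ultimately show ?thesis using False by (intro exI[of _ \<psi>] exI[of _ q]) simp
  qed
  then show ?case
  proof (elim exE conjE)
    fix \<psi> q assume \<psi>: "\<psi> \<in> S_time \<tau> N p" "degree q \<le> p" "C N q" "poly q (\<tau> N) = \<psi> (\<tau> N)"
      "if fwd then \<psi> (\<tau> 0) = \<alpha> else poly q (\<tau> (Suc N)) = \<alpha>"
      "\<forall>i<N. \<exists>q. C i q \<and> (\<forall>s\<in>{\<tau> i..\<tau> (Suc i)}. \<psi> s = poly q s)"
  let ?\<psi> = "\<lambda>s. if s \<le> \<tau> N then \<psi> s else poly q s"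
  have le: "\<tau> 0 \<le> \<tau> N" "\<And>i. i < N \<Longrightarrow> \<tau> (Suc i) \<le> \<tau> N" 
    using time_partition_mono[of \<tau> N "\<tau> N"] part by auto
  have 1: "?\<psi> \<in> S_time \<tau> (Suc N) p"
    using S_time_extend Suc.prems(1) \<psi> by blast
  have 2: "?\<psi> (\<tau> (if fwd then 0 else Suc N)) = \<alpha>"
    using \<psi>(5) le(1) part by (auto split: if_splits)
  have 3: "\<exists>q. C i q \<and> (\<forall>s\<in>{\<tau> i..\<tau> (Suc i)}. ?\<psi> s = poly q s)" if "i < Suc N" for i
  proof (cases "i = N")
    case True
    then show ?thesis using \<psi> by (intro exI[of _ q]) auto
  next
    case False
    then have i: "i < N" using that by simp
    then obtain r where "C i r" "\<forall>s\<in>{\<tau> i..\<tau> (Suc i)}. \<psi> s = poly r s"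
      using \<psi>(6) by blast
    then show ?thesis using le(2)[OF i] by (intro exI[of _ r]) auto
  qed
  show "\<exists>\<psi>\<in>S_time \<tau> (Suc N) p. \<psi> (\<tau> (if fwd then 0 else Suc N)) = \<alpha> \<and>
           (\<forall>i<Suc N. \<exists>q. C i q \<and> (\<forall>s\<in>{\<tau> i..\<tau> (Suc i)}. \<psi> s = poly q s))"
    using 2 3 by (intro bexI[OF _ 1] conjI allI impI)
  qed
qed

section \<open>Piecewise polynomials in time\<close>

locale time_mesh =
  fixes \<tau> :: "nat \<Rightarrow> real" and N :: nat and T :: real
  assumes part: "time_partition \<tau> N T"
begin

lemma node_0: "\<tau> 0 = 0" and node_N: "\<tau> N = T" and node_less: "i < N \<Longrightarrow> \<tau> i < \<tau> (Suc i)"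
  using part by (auto simp: time_partition_def)

lemma node_mono: "i \<le> j \<Longrightarrow> j \<le> N \<Longrightarrow> \<tau> i \<le> \<tau> j"
  using time_partition_mono[OF part] .

lemma time_covered_by_cells:
  assumes "n \<le> N" "t \<in> {0<..<\<tau> n}" "t \<notin> \<tau> ` {..n}"
  shows "\<exists>i<n. t \<in> {\<tau> i<..<\<tau> (Suc i)}"
  using assms
proof (induction n)
  case (Suc n)
  show ?case
  proof (cases "t < \<tau> n")
    case True
    then obtain i where "i < n" "t \<in> {\<tau> i<..<\<tau> (Suc i)}" using Suc by fastforce
    then show ?thesis using less_Suc_eq by blast
  next
    case False
    then have "\<tau> n < t" using Suc.prems by (metis atMost_iff imageI le_SucI linorder_neqE_linordered_idom order_refl)
    then show ?thesis using Suc.prems by (intro exI[of _ n]) auto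
  qed
qed (simp add: node_0)

abbreviation "time \<equiv> lebesgue_on {0<..<T}"

lemma AE_time_cells: "AE t in time. \<exists>i<N. t \<in> {\<tau> i<..<\<tau> (Suc i)}"
proof -
  have "\<tau> ` {..N} \<in> null_sets lebesgue"
    by (simp add: finite_imp_null_set_lborel null_sets_completionI)
  then have "AE t in lebesgue. t \<notin> \<tau> ` {..N}" by (rule AE_not_in)
  then show ?thesis
    using time_covered_by_cells[of N] by (auto simp: AE_restrict_space_iff node_N elim!: eventually_mono)
qed

lemma has_integral_cells:
  fixes f :: "real \<Rightarrow> real"
  assumes "\<And>i. i < N \<Longrightarrow> (f has_integral J i) {\<tau> i..\<tau> (Suc i)}"
  shows "(f has_integral (\<Sum>i<N. J i)) {0..T}"
proof -
  have "(f has_integral (\<Sum>i<n. J i)) {\<tau> 0..\<tau> n}" if "n \<le> N" for n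
    using that
  proof (induction n)
    case 0
    then show ?case by (simp add: has_integral_refl)
  next
    case (Suc n)
    have "(f has_integral (\<Sum>i<n. J i) + J n) {\<tau> 0..\<tau> (Suc n)}"
      using Suc assms node_mono[of 0 n] node_less[of n]
      by (intro has_integral_combine[where c = "\<tau> n"]) auto
    then show ?case by simp
  qed
  then show ?thesis using node_0 node_N by auto
qed

text \<open>Continuous splines, their derivatives and the products of such functions all belong to this class,
  which leaves the values at the nodes open.  Membership gives integrability in time.\<close>

definition piecewise_poly :: "(real \<Rightarrow> real) set" where
  "piecewise_poly = {f. \<forall>i<N. \<exists>q. \<forall>s\<in>{\<tau> i<..<\<tau> (Suc i)}. f s = poly q s}"

lemma piecewise_polyD:
  assumes "f \<in> piecewise_poly" "i < N"
  obtains q where "\<And>s. s \<in> {\<tau> i<..<\<tau> (Suc i)} \<Longrightarrow> f s = poly q s"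
  using assms by (auto simp: piecewise_poly_def)

lemma piecewise_poly_const: "(\<lambda>t. c) \<in> piecewise_poly"
  by (auto simp: piecewise_poly_def intro!: exI[of _ "[:c:]"])

lemma piecewise_poly_add:
  assumes "f \<in> piecewise_poly" "g \<in> piecewise_poly"
  shows "(\<lambda>t. f t + g t) \<in> piecewise_poly"
  unfolding piecewise_poly_def
proof (intro CollectI allI impI)
  fix i assume i: "i < N"
  obtain q r where "\<And>s. s \<in> {\<tau> i<..<\<tau> (Suc i)} \<Longrightarrow> f s = poly q s"
      "\<And>s. s \<in> {\<tau> i<..<\<tau> (Suc i)} \<Longrightarrow> g s = poly r s"
    using piecewise_polyD[OF _ i] assms by metis
  then show "\<exists>q. \<forall>s\<in>{\<tau> i<..<\<tau> (Suc i)}. f s + g s = poly q s"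
    by (intro exI[of _ "q + r"]) simp
qed

lemma piecewise_poly_mult:
  assumes "f \<in> piecewise_poly" "g \<in> piecewise_poly"
  shows "(\<lambda>t. f t * g t) \<in> piecewise_poly"
  unfolding piecewise_poly_def
proof (intro CollectI allI impI)
  fix i assume i: "i < N"
  obtain q r where "\<And>s. s \<in> {\<tau> i<..<\<tau> (Suc i)} \<Longrightarrow> f s = poly q s"
      "\<And>s. s \<in> {\<tau> i<..<\<tau> (Suc i)} \<Longrightarrow> g s = poly r s"
    using piecewise_polyD[OF _ i] assms by metis
  then show "\<exists>q. \<forall>s\<in>{\<tau> i<..<\<tau> (Suc i)}. f s * g s = poly q s"
    by (intro exI[of _ "q * r"]) simp
qed

lemma has_integral_spike_cell:
  assumes "\<And>s. s \<in> {a<..<b} \<Longrightarrow> f s = g s" "(g has_integral y) {a..b::real}"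
  shows "(f has_integral y) {a..b}"
  using has_integral_spike_interior[of g y a b f] assms by auto

lemma piecewise_poly_integrable_on:
  assumes "f \<in> piecewise_poly"
  shows "f integrable_on {0..T}"
proof -
  have "\<exists>y. (f has_integral y) {\<tau> i..\<tau> (Suc i)}" if i: "i < N" for i
    by (rule piecewise_polyD[OF assms i], rule exI, rule has_integral_spike_cell[OF _ poly_has_integral])
  then obtain J where "\<And>i. i < N \<Longrightarrow> (f has_integral J i) {\<tau> i..\<tau> (Suc i)}" by metis
  from has_integral_cells[OF this] show ?thesis by blast
qed

lemma piecewise_poly_integrable:
  assumes "f \<in> piecewise_poly"
  shows "integrable time f"
proof -
  \<comment> \<open>\<open>f\<^sup>2 + 1\<close> is again piecewise polynomial and dominates \<open>\<bar>f\<bar>\<close>, which need not be.\<close>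
  have "(\<lambda>t. f t * f t + 1) \<in> piecewise_poly"
    by (intro piecewise_poly_add piecewise_poly_mult assms piecewise_poly_const)
  then have "(\<lambda>t. f t * f t + 1) integrable_on {0<..<T}" "f integrable_on {0<..<T}"
    using piecewise_poly_integrable_on assms by (auto simp: integrable_on_open_interval_real)
  moreover have "\<bar>x\<bar> \<le> x * x + 1" for x :: real
  proof -
    have "0 \<le> (\<bar>x\<bar> - 1)\<^sup>2 + \<bar>x\<bar>" by simp
    then show ?thesis by (simp add: power2_eq_square algebra_simps)
  qed
  ultimately have "f absolutely_integrable_on {0<..<T}"
    by (intro absolutely_integrable_integrable_bound[of "{0<..<T}" f "\<lambda>t. f t * f t + 1"]) auto
  then show ?thesis by (intro absolutely_integrable_imp_integrable) auto
qed

lemma piecewise_poly_integral_eq: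
  assumes "f \<in> piecewise_poly" "(f has_integral y) {0..T}"
  shows "(LINT t|time. f t) = y"
proof -
  have "(LINT t|time. f t) = integral {0<..<T} f"
    by (rule lebesgue_integral_eq_integral[OF piecewise_poly_integrable[OF assms(1)]]) simp
  then show ?thesis using assms(2) by (simp add: integral_unique flip: integral_open_interval_real)
qed

lemma S_time_cell_derivative:
  assumes "\<psi> \<in> S_time \<tau> N p" "i < N"
  obtains q where "degree q \<le> p" "\<And>s. s \<in> {\<tau> i..\<tau> (Suc i)} \<Longrightarrow> \<psi> s = poly q s"
    "\<And>s. s \<in> {\<tau> i<..<\<tau> (Suc i)} \<Longrightarrow> (\<psi> has_real_derivative poly (pderiv q) s) (at s)"
    "\<And>s. s \<in> {\<tau> i<..<\<tau> (Suc i)} \<Longrightarrow> deriv \<psi> s = poly (pderiv q) s"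
proof -
  obtain q where q: "degree q \<le> p" "\<And>s. s \<in> {\<tau> i..\<tau> (Suc i)} \<Longrightarrow> \<psi> s = poly q s"
    using assms by (auto simp: S_time_def)
  have "(\<psi> has_real_derivative poly (pderiv q) s) (at s)" if "s \<in> {\<tau> i<..<\<tau> (Suc i)}" for s
    by (rule has_field_derivative_transform_within_open[OF poly_DERIV _ that]) (use q in auto)
  then show ?thesis using that q DERIV_imp_deriv by blast
qed

text \<open>From right to left, the pieces are integrated, and the constants of integration are chosen cell by
  cell so that the resulting function is continuous.\<close>

lemma dS_time_iff:
  "\<xi> \<in> dS_time \<tau> N p \<longleftrightarrow>
     (\<forall>i<N. \<exists>r. deg_less r p \<and> (\<forall>s\<in>{\<tau> i<..<\<tau> (Suc i)}. \<xi> s = poly r s))" (is "_ \<longleftrightarrow> ?R")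
proof
  assume "\<xi> \<in> dS_time \<tau> N p"
  then obtain \<psi> where \<psi>: "\<psi> \<in> S_time \<tau> N p" "\<forall>i<N. \<forall>s\<in>{\<tau> i<..<\<tau> (Suc i)}. \<xi> s = deriv \<psi> s"
    by (auto simp: dS_time_def)
  show ?R
  proof (intro allI impI)
    fix i assume i: "i < N"
    obtain q where "degree q \<le> p" "\<And>s. s \<in> {\<tau> i<..<\<tau> (Suc i)} \<Longrightarrow> deriv \<psi> s = poly (pderiv q) s"
      using S_time_cell_derivative[OF \<psi>(1) i] by metis
    then show "\<exists>r. deg_less r p \<and> (\<forall>s\<in>{\<tau> i<..<\<tau> (Suc i)}. \<xi> s = poly r s)"
      using \<psi>(2) i by (intro exI[of _ "pderiv q"]) (auto simp: deg_less_pderiv)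
  qed
next
  assume ?R
  then obtain r where r: "\<And>i. i < N \<Longrightarrow> deg_less (r i) p"
      "\<And>i s. i < N \<Longrightarrow> s \<in> {\<tau> i<..<\<tau> (Suc i)} \<Longrightarrow> \<xi> s = poly (r i) s"
    by metis
  have "\<exists>q. degree q \<le> p \<and> pderiv q = r i \<and> poly q (\<tau> (if True then i else Suc i)) = \<alpha>"
    if "i < N" for i \<alpha>
    using exists_antiderivative[OF r(1)[OF that]] by simp
  from glue_cells[where C = "\<lambda>i q. pderiv q = r i" and fwd = True and \<alpha> = 0, OF part this]
  obtain \<psi> where \<psi>: "\<psi> \<in> S_time \<tau> N p"
      "\<forall>i<N. \<exists>q. pderiv q = r i \<and> (\<forall>s\<in>{\<tau> i..\<tau> (Suc i)}. \<psi> s = poly q s)"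
    by blast
  have "\<xi> s = deriv \<psi> s" if i: "i < N" and s: "s \<in> {\<tau> i<..<\<tau> (Suc i)}" for i s
  proof -
    obtain q where q: "pderiv q = r i" "\<forall>s\<in>{\<tau> i..\<tau> (Suc i)}. \<psi> s = poly q s" using \<psi>(2) i by blast
    have "(\<psi> has_real_derivative poly (pderiv q) s) (at s)"
      by (rule has_field_derivative_transform_within_open[OF poly_DERIV _ s]) (use q in auto)
    then show ?thesis using r(2)[OF i s] q(1) by (simp add: DERIV_imp_deriv)
  qed
  then show "\<xi> \<in> dS_time \<tau> N p" using \<psi>(1) by (auto simp: dS_time_def)
qed

lemma S_time_piecewise_poly: "\<psi> \<in> S_time \<tau> N p \<Longrightarrow> \<psi> \<in> piecewise_poly"
  by (fastforce simp: S_time_def piecewise_poly_def)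

lemma dS_time_piecewise_poly: "\<xi> \<in> dS_time \<tau> N p \<Longrightarrow> \<xi> \<in> piecewise_poly"
  unfolding dS_time_iff piecewise_poly_def by blast

lemma deriv_S_time: "\<psi> \<in> S_time \<tau> N p \<Longrightarrow> deriv \<psi> \<in> dS_time \<tau> N p"
  by (auto simp: dS_time_def)

text \<open>On each cell this is the fundamental theorem of calculus for polynomials; by continuity at the
  nodes the boundary terms telescope.\<close>

lemma integration_by_parts_S_time:
  assumes "\<psi> \<in> S_time \<tau> N p" "\<phi> \<in> S_time \<tau> N p"
  shows "(LINT t|time. deriv \<psi> t * \<phi> t) + (LINT t|time. \<psi> t * deriv \<phi> t) = \<psi> T * \<phi> T - \<psi> 0 * \<phi> 0"
proof -
  let ?f = "\<lambda>t. deriv \<psi> t * \<phi> t + \<psi> t * deriv \<phi> t"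
  have pp: "\<psi> \<in> piecewise_poly" "\<phi> \<in> piecewise_poly" "deriv \<psi> \<in> piecewise_poly" "deriv \<phi> \<in> piecewise_poly"
    using assms deriv_S_time dS_time_piecewise_poly S_time_piecewise_poly by blast+
  have "(?f has_integral (\<psi> (\<tau> (Suc i)) * \<phi> (\<tau> (Suc i)) - \<psi> (\<tau> i) * \<phi> (\<tau> i))) {\<tau> i..\<tau> (Suc i)}"
    if i: "i < N" for i
  proof -
    obtain q where q: "\<And>s. s \<in> {\<tau> i..\<tau> (Suc i)} \<Longrightarrow> \<psi> s = poly q s"
        "\<And>s. s \<in> {\<tau> i<..<\<tau> (Suc i)} \<Longrightarrow> deriv \<psi> s = poly (pderiv q) s"
      using S_time_cell_derivative[OF assms(1) i] by metis
    obtain r where r: "\<And>s. s \<in> {\<tau> i..\<tau> (Suc i)} \<Longrightarrow> \<phi> s = poly r s"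
        "\<And>s. s \<in> {\<tau> i<..<\<tau> (Suc i)} \<Longrightarrow> deriv \<phi> s = poly (pderiv r) s"
      using S_time_cell_derivative[OF assms(2) i] by metis
    have "(poly (pderiv (q * r)) has_integral (poly (q * r) (\<tau> (Suc i)) - poly (q * r) (\<tau> i))) {\<tau> i..\<tau> (Suc i)}"
      by (rule fundamental_theorem_of_calculus)
        (use node_less[OF i] in \<open>auto intro!: DERIV_subset[OF poly_DERIV] simp flip: has_real_derivative_iff_has_vector_derivative simp del: poly_mult\<close>)
    then have "(poly (pderiv (q * r)) has_integral (\<psi> (\<tau> (Suc i)) * \<phi> (\<tau> (Suc i)) - \<psi> (\<tau> i) * \<phi> (\<tau> i))) {\<tau> i..\<tau> (Suc i)}"
      using q(1) r(1) node_less[OF i] by simp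
    then show ?thesis
      by (rule has_integral_spike_cell[rotated]) (simp add: q r pderiv_mult)
  qed
  from has_integral_cells[OF this]
  have "(?f has_integral (\<psi> T * \<phi> T - \<psi> 0 * \<phi> 0)) {0..T}"
    using sum_lessThan_telescope[of "\<lambda>i. \<psi> (\<tau> i) * \<phi> (\<tau> i)" N] by (simp add: node_0 node_N)
  then have "(LINT t|time. ?f t) = \<psi> T * \<phi> T - \<psi> 0 * \<phi> 0"
    by (intro piecewise_poly_integral_eq piecewise_poly_add piecewise_poly_mult pp)
  moreover have "(LINT t|time. ?f t) = (LINT t|time. deriv \<psi> t * \<phi> t) + (LINT t|time. \<psi> t * deriv \<phi> t)"
    by (intro Bochner_Integration.integral_add piecewise_poly_integrable piecewise_poly_mult pp)
  ultimately show ?thesis by simp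
qed

section \<open>The projection in time for functions of time alone\<close>

text \<open>For \<open>\<xi>\<close> in \<^term>\<open>dS_time \<tau> N p\<close> this says that \<open>\<xi>\<close> is the orthogonal projection of \<open>\<psi>\<close> onto that space.\<close>

definition same_moments :: "nat \<Rightarrow> (real \<Rightarrow> real) \<Rightarrow> (real \<Rightarrow> real) \<Rightarrow> bool" where
  "same_moments p \<psi> \<xi> \<longleftrightarrow>
     (\<forall>\<eta>\<in>dS_time \<tau> N p. (LINT t|time. \<xi> t * \<eta> t) = (LINT t|time. \<psi> t * \<eta> t))"

text \<open>Discontinuous test functions decouple the cells, so orthogonality can be checked on each of them.\<close>

lemma same_moments_cells:
  assumes pp: "\<psi> \<in> piecewise_poly" "\<xi> \<in> piecewise_poly"
    and cells: "\<And>i. i < N \<Longrightarrow> \<exists>q r. (\<forall>s\<in>{\<tau> i<..<\<tau> (Suc i)}. \<psi> s = poly q s) \<and>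
        (\<forall>s\<in>{\<tau> i<..<\<tau> (Suc i)}. \<xi> s = poly r s) \<and> orthogonal_below (\<tau> i) (\<tau> (Suc i)) p (q - r)"
  shows "same_moments p \<psi> \<xi>"
  unfolding same_moments_def
proof
  fix \<eta> assume \<eta>: "\<eta> \<in> dS_time \<tau> N p"
  let ?f = "\<lambda>t. \<psi> t * \<eta> t - \<xi> t * \<eta> t"
  have "(?f has_integral 0) {\<tau> i..\<tau> (Suc i)}" if i: "i < N" for i
  proof -
    obtain q r where qr: "\<forall>s\<in>{\<tau> i<..<\<tau> (Suc i)}. \<psi> s = poly q s"
        "\<forall>s\<in>{\<tau> i<..<\<tau> (Suc i)}. \<xi> s = poly r s" "orthogonal_below (\<tau> i) (\<tau> (Suc i)) p (q - r)"
      using cells[OF i] by blast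
    obtain s where s: "deg_less s p" "\<forall>t\<in>{\<tau> i<..<\<tau> (Suc i)}. \<eta> t = poly s t"
      using \<eta> i unfolding dS_time_iff by blast
    have "integral {\<tau> i..\<tau> (Suc i)} (poly ((q - r) * s)) = 0"
      using qr(3) s(1) by (simp add: orthogonal_below_def)
    then have "(poly ((q - r) * s) has_integral 0) {\<tau> i..\<tau> (Suc i)}"
      by (metis poly_has_integral)
    then show ?thesis
      by (rule has_integral_spike_cell[rotated]) (use qr s in \<open>simp add: algebra_simps\<close>)
  qed
  from has_integral_cells[OF this] have "(?f has_integral 0) {0..T}" by simp
  moreover have i: "(\<lambda>t. \<psi> t * \<eta> t) \<in> piecewise_poly" "(\<lambda>t. \<xi> t * \<eta> t) \<in> piecewise_poly"
    using \<eta> pp dS_time_piecewise_poly piecewise_poly_mult by blast+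
  moreover have "?f \<in> piecewise_poly"
    using piecewise_poly_add[OF i(1) piecewise_poly_mult[OF piecewise_poly_const[of "-1"] i(2)]] by simp
  ultimately show "(LINT t|time. \<xi> t * \<eta> t) = (LINT t|time. \<psi> t * \<eta> t)"
    using piecewise_poly_integral_eq[of ?f 0]
      Bochner_Integration.integral_diff[OF piecewise_poly_integrable[OF i(1)] piecewise_poly_integrable[OF i(2)]]
    by simp
qed

lemma exists_S_time_projection:
  assumes "\<psi> \<in> S_time \<tau> N p"
  shows "\<exists>\<xi>\<in>dS_time \<tau> N p. same_moments p \<psi> \<xi>"
proof -
  have "\<exists>q r. (\<forall>s\<in>{\<tau> i<..<\<tau> (Suc i)}. \<psi> s = poly q s) \<and> deg_less r p \<and>
      orthogonal_below (\<tau> i) (\<tau> (Suc i)) p (q - r)" if i: "i < N" for i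
    using piecewise_polyD[OF S_time_piecewise_poly[OF assms] i] exists_poly_projection[OF node_less[OF i]] by metis
  then obtain q r where qr: "\<And>i s. i < N \<Longrightarrow> s \<in> {\<tau> i<..<\<tau> (Suc i)} \<Longrightarrow> \<psi> s = poly (q i) s"
      "\<And>i. i < N \<Longrightarrow> deg_less (r i) p"
      "\<And>i. i < N \<Longrightarrow> orthogonal_below (\<tau> i) (\<tau> (Suc i)) p (q i - r i)"
    by metis
  \<comment> \<open>At a node no such \<open>i\<close> exists and the value is arbitrary, as \<^const>\<open>dS_time\<close> permits.\<close>
  define \<xi> where "\<xi> t = poly (r (THE i. i < N \<and> t \<in> {\<tau> i<..<\<tau> (Suc i)})) t" for t
  have cell_unique: "j = i" if "i < N" "j < N" "t \<in> {\<tau> i<..<\<tau> (Suc i)}" "t \<in> {\<tau> j<..<\<tau> (Suc j)}" for i j t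
    using that node_mono[of "Suc i" j] node_mono[of "Suc j" i] by (cases i j rule: linorder_cases) auto
  have \<xi>: "\<xi> t = poly (r i) t" if "i < N" "t \<in> {\<tau> i<..<\<tau> (Suc i)}" for i t
  proof -
    have "(THE i. i < N \<and> t \<in> {\<tau> i<..<\<tau> (Suc i)}) = i"
      by (rule the_equality) (use that cell_unique in blast)+
    then show ?thesis by (simp add: \<xi>_def)
  qed
  then have "\<xi> \<in> dS_time \<tau> N p" unfolding dS_time_iff using qr(2) by blast
  moreover from this have "same_moments p \<psi> \<xi>"
    by (intro same_moments_cells S_time_piecewise_poly[OF assms] dS_time_piecewise_poly)
      (use qr \<xi> in blast)+
  ultimately show ?thesis by blast
qed

text \<open>The projection maps continuous splines onto discontinuous ones even if the initial
  (\<open>fwd\<close>) or the final (\<open>\<not> fwd\<close>) value is prescribed: the cellwise condition leaves one degree of freedom per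
  cell, which continuity and the prescribed value use up.\<close>

lemma exists_S_time_preimage:
  assumes "\<xi> \<in> dS_time \<tau> N p"
  shows "\<exists>\<psi>\<in>S_time \<tau> N p. \<psi> (\<tau> (if fwd then 0 else N)) = \<alpha> \<and> same_moments p \<psi> \<xi>"
proof -
  obtain r where r: "\<And>i. i < N \<Longrightarrow> deg_less (r i) p"
      "\<And>i. i < N \<Longrightarrow> \<forall>s\<in>{\<tau> i<..<\<tau> (Suc i)}. \<xi> s = poly (r i) s"
    using assms unfolding dS_time_iff by metis
  have "\<exists>q. degree q \<le> p \<and> orthogonal_below (\<tau> i) (\<tau> (Suc i)) p (q - r i) \<and>
      poly q (\<tau> (if fwd then i else Suc i)) = \<alpha>" if i: "i < N" for i \<alpha>
    using exists_poly_prescribed_projection[OF node_less[OF i] r(1)[OF i], of "\<tau> (if fwd then i else Suc i)" \<alpha>]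
    by auto
  from glue_cells[where C = "\<lambda>i q. orthogonal_below (\<tau> i) (\<tau> (Suc i)) p (q - r i)" and fwd = fwd and \<alpha> = \<alpha>, OF part this]
  obtain \<psi> where \<psi>: "\<psi> \<in> S_time \<tau> N p" "\<psi> (\<tau> (if fwd then 0 else N)) = \<alpha>"
      "\<forall>i<N. \<exists>q. orthogonal_below (\<tau> i) (\<tau> (Suc i)) p (q - r i) \<and> (\<forall>s\<in>{\<tau> i..\<tau> (Suc i)}. \<psi> s = poly q s)"
    by blast
  have "same_moments p \<psi> \<xi>"
  proof (rule same_moments_cells)
    fix i assume i: "i < N"
    obtain q where "orthogonal_below (\<tau> i) (\<tau> (Suc i)) p (q - r i)" "\<forall>s\<in>{\<tau> i..\<tau> (Suc i)}. \<psi> s = poly q s"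
      using \<psi>(3) i by blast
    then show "\<exists>q r. (\<forall>s\<in>{\<tau> i<..<\<tau> (Suc i)}. \<psi> s = poly q s) \<and>
        (\<forall>s\<in>{\<tau> i<..<\<tau> (Suc i)}. \<xi> s = poly r s) \<and> orthogonal_below (\<tau> i) (\<tau> (Suc i)) p (q - r)"
      using r(2)[OF i] by (intro exI[of _ q] exI[of _ "r i"]) auto
  qed (use \<psi>(1) assms S_time_piecewise_poly dS_time_piecewise_poly in auto)
  then show ?thesis using \<psi> by blast
qed

end

section \<open>Square integrable functions and tensor products\<close>

text \<open>Lebesgue measure is complete, so changing a function on a null set preserves both measurability
  and non-measurability; in the latter case both integrals are \<open>0\<close>.\<close>

lemma integral_lebesgue_on_cong_AE:
  fixes f g :: "'a::euclidean_space \<Rightarrow> real"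
  assumes S: "S \<in> sets lebesgue" and eq: "AE x in lebesgue_on S. f x = g x"
  shows "(LINT x|lebesgue_on S. f x) = (LINT x|lebesgue_on S. g x)"
proof -
  have "AE x in lebesgue. (if x \<in> S then f x else 0) = (if x \<in> S then g x else 0)"
    using eq S by (auto simp: AE_restrict_space_iff elim!: eventually_mono)
  then have "f \<in> borel_measurable (lebesgue_on S) \<longleftrightarrow> g \<in> borel_measurable (lebesgue_on S)"
    unfolding borel_measurable_if[OF S, symmetric] by (auto elim!: borel_measurable_AE eventually_mono)
  then show ?thesis
    using integral_cong_AE[OF _ _ eq] not_integrable_integral_eq borel_measurable_integrable by metis
qed

lemma L2_mult_integrable:
  fixes f g :: "real^'n \<Rightarrow> real"
  assumes "f \<in> L2 \<Omega>" "g \<in> L2 \<Omega>"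
  shows "integrable (lebesgue_on \<Omega>) (\<lambda>x. f x * g x)"
proof (rule Bochner_Integration.integrable_bound)
  show "integrable (lebesgue_on \<Omega>) (\<lambda>x. (f x)\<^sup>2 + (g x)\<^sup>2)"
    using assms by (intro Bochner_Integration.integrable_add) (auto simp: L2_def)
  show "(\<lambda>x. f x * g x) \<in> borel_measurable (lebesgue_on \<Omega>)"
    by (rule borel_measurable_times) (use assms in \<open>simp_all add: L2_def\<close>)
  have "\<bar>a * b\<bar> \<le> a\<^sup>2 + b\<^sup>2" for a b :: real
  proof -
    have "2 * (\<bar>a\<bar> * \<bar>b\<bar>) \<le> a\<^sup>2 + b\<^sup>2" "0 \<le> \<bar>a\<bar> * \<bar>b\<bar>"
      using sum_squares_bound[of "\<bar>a\<bar>" "\<bar>b\<bar>"] by simp_all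
    then show ?thesis unfolding abs_mult by linarith
  qed
  then show "AE x in lebesgue_on \<Omega>. norm (f x * g x) \<le> norm ((f x)\<^sup>2 + (g x)\<^sup>2)"
    by simp
qed

lemma L2_add:
  fixes f g :: "real^'n \<Rightarrow> real"
  assumes "f \<in> L2 \<Omega>" "g \<in> L2 \<Omega>"
  shows "(\<lambda>x. f x + g x) \<in> L2 \<Omega>"
proof -
  have "integrable (lebesgue_on \<Omega>) (\<lambda>x. (f x * f x + g x * g x) + 2 * (f x * g x))"
    by (intro Bochner_Integration.integrable_add integrable_mult_right L2_mult_integrable assms)
  then show ?thesis using assms
    by (auto simp: L2_def power2_eq_square algebra_simps intro!: borel_measurable_add)
qed

lemma L2_scale:
  fixes f :: "real^'n \<Rightarrow> real"
  assumes "f \<in> L2 \<Omega>"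
  shows "(\<lambda>x. f x * a) \<in> L2 \<Omega>"
  using assms by (auto simp: L2_def power_mult_distrib)

lemma L2_sum:
  fixes f :: "'i \<Rightarrow> real^'n \<Rightarrow> real"
  assumes "\<And>k. k \<in> A \<Longrightarrow> f k \<in> L2 \<Omega>"
  shows "(\<lambda>x. \<Sum>k\<in>A. f k x) \<in> L2 \<Omega>"
  using assms
proof (induction A rule: infinite_finite_induct)
  case (insert x F)
  then show ?case by (simp add: L2_add)
qed (simp_all add: L2_def)

definition tensor_sum :: "nat \<Rightarrow> (nat \<Rightarrow> 'a \<Rightarrow> real) \<Rightarrow> (nat \<Rightarrow> 'b \<Rightarrow> real) \<Rightarrow> 'a \<Rightarrow> 'b \<Rightarrow> real" where
  "tensor_sum m v \<psi> = (\<lambda>x t. \<Sum>k<m. v k x * \<psi> k t)"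

lemma tensorE:
  assumes "U \<in> tensor A B"
  obtains m v \<psi> where "\<And>k. k < m \<Longrightarrow> v k \<in> A" "\<And>k. k < m \<Longrightarrow> \<psi> k \<in> B" "U = tensor_sum m v \<psi>"
  using assms unfolding tensor_def mem_Collect_eq tensor_sum_def[symmetric]
proof (elim exE conjE)
  fix m v \<psi> assume "\<forall>k<m. v k \<in> A \<and> \<psi> k \<in> B" "U = tensor_sum m v \<psi>"
  then show thesis by (intro that[of m v \<psi>]) auto
qed

lemma tensorI:
  "(\<And>k. k < m \<Longrightarrow> v k \<in> A) \<Longrightarrow> (\<And>k. k < m \<Longrightarrow> \<psi> k \<in> B) \<Longrightarrow> tensor_sum m v \<psi> \<in> tensor A B"
  unfolding tensor_def tensor_sum_def by blast

lemma tensor_mono: "A \<subseteq> A' \<Longrightarrow> B \<subseteq> B' \<Longrightarrow> tensor A B \<subseteq> tensor A' B'"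
  unfolding tensor_def by blast

lemma tensor_diff:
  assumes A: "\<And>u. u \<in> A \<Longrightarrow> (\<lambda>x. - u x) \<in> A" and U: "U \<in> tensor A B" and W: "W \<in> tensor A B"
  shows "(\<lambda>x t. U x t - W x t) \<in> tensor A B"
proof -
  obtain m v \<psi> where v: "\<And>k. k < m \<Longrightarrow> v k \<in> A" "\<And>k. k < m \<Longrightarrow> \<psi> k \<in> B" "U = tensor_sum m v \<psi>"
    using U by (rule tensorE) blast
  obtain n w \<phi> where w: "\<And>k. k < n \<Longrightarrow> w k \<in> A" "\<And>k. k < n \<Longrightarrow> \<phi> k \<in> B" "W = tensor_sum n w \<phi>"
    using W by (rule tensorE) blast
  define z where "z k = (if k < m then v k else (\<lambda>x. - w (k - m) x))" for k
  define \<zeta> where "\<zeta> k = (if k < m then \<psi> k else \<phi> (k - m))" for k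
  have "(\<Sum>k<m + n'. z k x * \<zeta> k t) = (\<Sum>k<m. v k x * \<psi> k t) - (\<Sum>k<n'. w k x * \<phi> k t)" for n' x t
    by (induction n') (simp_all add: z_def \<zeta>_def algebra_simps)
  then have "(\<lambda>x t. U x t - W x t) = tensor_sum (m + n) z \<zeta>"
    by (simp add: v(3) w(3) tensor_sum_def)
  moreover have "tensor_sum (m + n) z \<zeta> \<in> tensor A B"
    by (rule tensorI) (use v w A in \<open>auto simp: z_def \<zeta>_def\<close>)
  ultimately show ?thesis by simp
qed

lemma L2_inner_commute: "L2_inner \<Omega> f g = L2_inner \<Omega> g f"
  by (simp add: L2_inner_def inner_commute)

lemma QT_inner_commute: "QT_inner \<Omega> T U W = QT_inner \<Omega> T W U"
  unfolding QT_inner_def by (subst L2_inner_commute) simp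

lemma L2_inner_diff_left:
  fixes f g h :: "real^'n \<Rightarrow> real"
  assumes "f \<in> L2 \<Omega>" "g \<in> L2 \<Omega>" "h \<in> L2 \<Omega>"
  shows "L2_inner \<Omega> (\<lambda>x. f x - g x) h = L2_inner \<Omega> f h - L2_inner \<Omega> g h"
  using Bochner_Integration.integral_diff[OF L2_mult_integrable[OF assms(1,3)] L2_mult_integrable[OF assms(2,3)]]
  by (simp add: L2_inner_def algebra_simps)

lemma L2_inner_tensor_sums:
  fixes v w :: "nat \<Rightarrow> real^'n \<Rightarrow> real"
  assumes v: "\<And>k. k < m \<Longrightarrow> v k \<in> L2 \<Omega>" and w: "\<And>l. l < n \<Longrightarrow> w l \<in> L2 \<Omega>"
  shows "L2_inner \<Omega> (\<lambda>x. tensor_sum m v f x t) (\<lambda>x. tensor_sum n w g x t)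
      = (\<Sum>k<m. \<Sum>l<n. L2_inner \<Omega> (v k) (w l) * (f k t * g l t))"
proof -
  have int: "integrable (lebesgue_on \<Omega>) (\<lambda>x. v k x * w l x * (f k t * g l t))" if "k < m" "l < n" for k l
    by (intro integrable_mult_left L2_mult_integrable v w that)
  have "L2_inner \<Omega> (\<lambda>x. tensor_sum m v f x t) (\<lambda>x. tensor_sum n w g x t)
      = (LINT x|lebesgue_on \<Omega>. (\<Sum>k<m. \<Sum>l<n. v k x * w l x * (f k t * g l t)))"
    by (simp add: L2_inner_def tensor_sum_def sum_product mult_ac)
  also have "\<dots> = (\<Sum>k<m. (LINT x|lebesgue_on \<Omega>. (\<Sum>l<n. v k x * w l x * (f k t * g l t))))"
    by (intro Bochner_Integration.integral_sum Bochner_Integration.integrable_sum int) auto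
  also have "\<dots> = (\<Sum>k<m. \<Sum>l<n. (LINT x|lebesgue_on \<Omega>. v k x * w l x * (f k t * g l t)))"
    by (intro sum.cong refl Bochner_Integration.integral_sum int) auto
  finally show ?thesis by (simp add: L2_inner_def)
qed

text \<open>The defining property of a weak gradient sees \<open>u\<close> only through integrals, so two almost everywhere
  equal functions admit the same weak gradients and the choice in \<^const>\<open>grad\<close> falls on the same one.\<close>

lemma grad_cong_AE:
  assumes \<Omega>: "\<Omega> \<in> sets lebesgue" and eq: "AE x in lebesgue_on \<Omega>. u x = w x"
  shows "grad \<Omega> u = grad \<Omega> w"
proof -
  have "L2_inner \<Omega> u \<phi> = L2_inner \<Omega> w \<phi>" for \<phi>
    unfolding L2_inner_def
    by (rule integral_lebesgue_on_cong_AE[OF \<Omega>]) (use eq in \<open>auto elim!: eventually_mono\<close>)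
  then show ?thesis by (simp add: grad_def has_weak_gradient_def)
qed

section \<open>Pairings of space-time functions\<close>

locale space_time_mesh = time_mesh \<tau> N T for \<tau> N T +
  fixes \<Omega> :: "(real^'n) set"
  assumes domain_measurable: "\<Omega> \<in> sets lebesgue"
begin

lemma QT_inner_cong:
  fixes U W :: "real^'n \<Rightarrow> real \<Rightarrow> real"
  assumes "QT_eq \<Omega> T W W'"
  shows "QT_inner \<Omega> T U W = QT_inner \<Omega> T U W'"
  unfolding QT_inner_def
proof (rule integral_lebesgue_on_cong_AE)
  show "AE t in time. L2_inner \<Omega> (\<lambda>x. U x t) (\<lambda>x. W x t) = L2_inner \<Omega> (\<lambda>x. U x t) (\<lambda>x. W' x t)"
    using assms unfolding QT_eq_def
  proof (rule eventually_mono)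
    fix t assume "AE x in lebesgue_on \<Omega>. W x t = W' x t"
    then show "L2_inner \<Omega> (\<lambda>x. U x t) (\<lambda>x. W x t) = L2_inner \<Omega> (\<lambda>x. U x t) (\<lambda>x. W' x t)"
      unfolding L2_inner_def
      by (intro integral_lebesgue_on_cong_AE[OF domain_measurable]) (auto elim!: eventually_mono)
  qed
qed simp

lemma stiffness_cong:
  assumes "QT_eq \<Omega> T W W'"
  shows "stiffness \<Omega> T c U W = stiffness \<Omega> T c U W'"
  unfolding stiffness_def QT_inner_def gradx_def
proof (rule integral_lebesgue_on_cong_AE)
  show "AE t in time. L2_inner \<Omega> (\<lambda>x. (c x)\<^sup>2 *\<^sub>R grad \<Omega> (\<lambda>y. U y t) x) (\<lambda>x. grad \<Omega> (\<lambda>y. W y t) x)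
      = L2_inner \<Omega> (\<lambda>x. (c x)\<^sup>2 *\<^sub>R grad \<Omega> (\<lambda>y. U y t) x) (\<lambda>x. grad \<Omega> (\<lambda>y. W' y t) x)"
    using assms unfolding QT_eq_def
    by (rule eventually_mono) (simp add: grad_cong_AE[OF domain_measurable])
qed simp

lemma QT_eq_sym: "QT_eq \<Omega> T U W \<Longrightarrow> QT_eq \<Omega> T W U"
  unfolding QT_eq_def by (auto elim!: eventually_mono)

lemma QT_eq_trans: "QT_eq \<Omega> T U W \<Longrightarrow> QT_eq \<Omega> T W Z \<Longrightarrow> QT_eq \<Omega> T U Z"
  unfolding QT_eq_def by (elim eventually_elim2) (auto elim: eventually_elim2)

lemma tensor_slice_L2:
  assumes "U \<in> tensor (L2 \<Omega>) B"
  shows "(\<lambda>x. U x t) \<in> L2 \<Omega>"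
  using assms by (elim tensorE) (auto simp: tensor_sum_def intro!: L2_sum L2_scale)

lemma slice_inner_tensor_sums:
  assumes v: "\<And>k. k < m \<Longrightarrow> v k \<in> L2 \<Omega>" and w: "\<And>l. l < n \<Longrightarrow> w l \<in> L2 \<Omega>"
    and f: "\<And>k. k < m \<Longrightarrow> f k \<in> piecewise_poly" and g: "\<And>l. l < n \<Longrightarrow> g l \<in> piecewise_poly"
  shows "integrable time (\<lambda>t. L2_inner \<Omega> (\<lambda>x. tensor_sum m v f x t) (\<lambda>x. tensor_sum n w g x t))" (is ?int)
    and "QT_inner \<Omega> T (tensor_sum m v f) (tensor_sum n w g)
        = (\<Sum>k<m. \<Sum>l<n. L2_inner \<Omega> (v k) (w l) * (LINT t|time. f k t * g l t))" (is ?eq)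
proof -
  have int: "integrable time (\<lambda>t. L2_inner \<Omega> (v k) (w l) * (f k t * g l t))" if "k < m" "l < n" for k l
    by (intro integrable_mult_right piecewise_poly_integrable piecewise_poly_mult f g that)
  have slice: "(\<lambda>t. L2_inner \<Omega> (\<lambda>x. tensor_sum m v f x t) (\<lambda>x. tensor_sum n w g x t))
      = (\<lambda>t. \<Sum>k<m. \<Sum>l<n. L2_inner \<Omega> (v k) (w l) * (f k t * g l t))"
    by (intro ext L2_inner_tensor_sums v w)
  show ?int
    unfolding slice by (intro Bochner_Integration.integrable_sum int) auto
  have "QT_inner \<Omega> T (tensor_sum m v f) (tensor_sum n w g)
      = (LINT t|time. (\<Sum>k<m. \<Sum>l<n. L2_inner \<Omega> (v k) (w l) * (f k t * g l t)))"
    unfolding QT_inner_def slice ..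
  also have "\<dots> = (\<Sum>k<m. (LINT t|time. (\<Sum>l<n. L2_inner \<Omega> (v k) (w l) * (f k t * g l t))))"
    by (intro Bochner_Integration.integral_sum Bochner_Integration.integrable_sum int) auto
  also have "\<dots> = (\<Sum>k<m. \<Sum>l<n. (LINT t|time. L2_inner \<Omega> (v k) (w l) * (f k t * g l t)))"
    by (intro sum.cong refl Bochner_Integration.integral_sum int) auto
  finally show ?eq by simp
qed

lemma slice_inner_integrable:
  assumes "U \<in> tensor (L2 \<Omega>) piecewise_poly" "W \<in> tensor (L2 \<Omega>) piecewise_poly"
  shows "integrable time (\<lambda>t. L2_inner \<Omega> (\<lambda>x. U x t) (\<lambda>x. W x t))"
  using assms by (elim tensorE) (simp add: slice_inner_tensor_sums(1))

lemma QT_inner_diff_left: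
  assumes "U \<in> tensor (L2 \<Omega>) piecewise_poly" "W \<in> tensor (L2 \<Omega>) piecewise_poly"
    "Z \<in> tensor (L2 \<Omega>) piecewise_poly"
  shows "QT_inner \<Omega> T (\<lambda>x t. U x t - W x t) Z = QT_inner \<Omega> T U Z - QT_inner \<Omega> T W Z"
  unfolding QT_inner_def
  using Bochner_Integration.integral_diff[OF slice_inner_integrable[OF assms(1,3)] slice_inner_integrable[OF assms(2,3)]]
  by (simp add: L2_inner_diff_left[OF tensor_slice_L2[OF assms(1)] tensor_slice_L2[OF assms(2)] tensor_slice_L2[OF assms(3)]])

lemma QT_eq_if_QT_inner_diff_self_0:
  assumes U: "U \<in> tensor (L2 \<Omega>) piecewise_poly" and W: "W \<in> tensor (L2 \<Omega>) piecewise_poly"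
    and 0: "QT_inner \<Omega> T (\<lambda>x t. U x t - W x t) (\<lambda>x t. U x t - W x t) = 0"
  shows "QT_eq \<Omega> T U W"
proof -
  let ?D = "\<lambda>x t. U x t - W x t"
  have D: "?D \<in> tensor (L2 \<Omega>) piecewise_poly"
    by (rule tensor_diff[OF _ U W]) (use L2_scale[of _ \<Omega> "-1"] in auto)
  have sq: "0 \<le> L2_inner \<Omega> f f" for f :: "real^'n \<Rightarrow> real" by (simp add: L2_inner_def)
  have "AE t in time. L2_inner \<Omega> (\<lambda>x. ?D x t) (\<lambda>x. ?D x t) = 0"
    using integral_nonneg_eq_0_iff_AE[OF slice_inner_integrable[OF D D]] 0 sq by (simp add: QT_inner_def)
  then show ?thesis unfolding QT_eq_def
  proof (rule eventually_mono)
    fix t assume *: "L2_inner \<Omega> (\<lambda>x. ?D x t) (\<lambda>x. ?D x t) = 0"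
    have "integrable (lebesgue_on \<Omega>) (\<lambda>x. ?D x t * ?D x t)"
      by (intro L2_mult_integrable tensor_slice_L2[OF D])
    from integral_nonneg_eq_0_iff_AE[OF this] * have "AE x in lebesgue_on \<Omega>. ?D x t * ?D x t = 0"
      by (simp add: L2_inner_def)
    then show "AE x in lebesgue_on \<Omega>. U x t = W x t" by (auto elim!: eventually_mono)
  qed
qed

text \<open>Only almost everywhere, because at a node \<^const>\<open>deriv\<close> may take an arbitrary value, which need not
  be linear in the function.\<close>

lemma dt_tensor_sum:
  assumes \<psi>: "\<And>k. k < m \<Longrightarrow> \<psi> k \<in> S_time \<tau> N p"
  shows "QT_eq \<Omega> T (dt (tensor_sum m v \<psi>)) (tensor_sum m v (\<lambda>k. deriv (\<psi> k)))"
  unfolding QT_eq_def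
  using AE_time_cells
proof (rule eventually_mono)
  fix t assume "\<exists>i<N. t \<in> {\<tau> i<..<\<tau> (Suc i)}"
  then obtain i where i: "i < N" "t \<in> {\<tau> i<..<\<tau> (Suc i)}" by blast
  have "(\<psi> k has_real_derivative deriv (\<psi> k) t) (at t)" if "k < m" for k
    using S_time_cell_derivative[OF \<psi>[OF that] i(1)] i(2) by metis
  then have "(tensor_sum m v \<psi> x has_real_derivative tensor_sum m v (\<lambda>k. deriv (\<psi> k)) x t) (at t)" for x
    unfolding tensor_sum_def by (intro DERIV_sum DERIV_cmult) auto
  then show "AE x in lebesgue_on \<Omega>. dt (tensor_sum m v \<psi>) x t = tensor_sum m v (\<lambda>k. deriv (\<psi> k)) x t"
    by (intro AE_I2) (simp add: dt_def DERIV_imp_deriv)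
qed

lemma dt_tensor:
  assumes "W \<in> tensor A (S_time \<tau> N p)"
  shows "\<exists>\<eta>\<in>tensor A (dS_time \<tau> N p). QT_eq \<Omega> T (dt W) \<eta>"
  using assms
proof (rule tensorE)
  fix m v \<psi> assume "\<And>k. k < m \<Longrightarrow> v k \<in> A" and \<psi>: "\<And>k. k < m \<Longrightarrow> \<psi> k \<in> S_time \<tau> N p"
    and W: "W = tensor_sum m v \<psi>"
  then have "tensor_sum m v (\<lambda>k. deriv (\<psi> k)) \<in> tensor A (dS_time \<tau> N p)"
    by (intro tensorI deriv_S_time)
  then show ?thesis using dt_tensor_sum[of m \<psi> p v] \<psi> unfolding W by blast
qed

lemma dS_tensor_is_dt:
  assumes "\<eta> \<in> tensor A (dS_time \<tau> N p)"
  shows "\<exists>W\<in>tensor A (S_time \<tau> N p). QT_eq \<Omega> T (dt W) \<eta>"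
  using assms
proof (rule tensorE)
  fix m v \<xi> assume v: "\<And>k. k < m \<Longrightarrow> v k \<in> A" and \<xi>: "\<And>k. k < m \<Longrightarrow> \<xi> k \<in> dS_time \<tau> N p"
    and \<eta>: "\<eta> = tensor_sum m v \<xi>"
  from \<xi> obtain \<psi> where \<psi>: "\<And>k. k < m \<Longrightarrow> \<psi> k \<in> S_time \<tau> N p"
      "\<And>k i s. k < m \<Longrightarrow> i < N \<Longrightarrow> s \<in> {\<tau> i<..<\<tau> (Suc i)} \<Longrightarrow> \<xi> k s = deriv (\<psi> k) s"
    unfolding dS_time_def mem_Collect_eq by metis
  have "QT_eq \<Omega> T (tensor_sum m v (\<lambda>k. deriv (\<psi> k))) \<eta>"
    unfolding QT_eq_def \<eta> using AE_time_cells
  proof (rule eventually_mono)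
    fix t assume "\<exists>i<N. t \<in> {\<tau> i<..<\<tau> (Suc i)}"
    then have "\<xi> k t = deriv (\<psi> k) t" if "k < m" for k using \<psi>(2) that by blast
    then show "AE x in lebesgue_on \<Omega>. tensor_sum m v (\<lambda>k. deriv (\<psi> k)) x t = tensor_sum m v \<xi> x t"
      by (simp add: tensor_sum_def)
  qed
  then have "QT_eq \<Omega> T (dt (tensor_sum m v \<psi>)) \<eta>"
    using dt_tensor_sum[of m \<psi> p v] \<psi>(1) QT_eq_trans by blast
  then show ?thesis using tensorI[of m v A \<psi>] v \<psi>(1) by blast
qed

lemma integration_by_parts_tensor:
  assumes "V \<in> tensor (L2 \<Omega>) (S_time \<tau> N p)" "W \<in> tensor (L2 \<Omega>) (S_time \<tau> N p)"
  shows "QT_inner \<Omega> T (dt V) W + QT_inner \<Omega> T V (dt W)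
      = L2_inner \<Omega> (\<lambda>x. V x T) (\<lambda>x. W x T) - L2_inner \<Omega> (\<lambda>x. V x 0) (\<lambda>x. W x 0)"
proof -
  obtain m v \<psi> where v: "\<And>k. k < m \<Longrightarrow> v k \<in> L2 \<Omega>" "\<And>k. k < m \<Longrightarrow> \<psi> k \<in> S_time \<tau> N p"
      "V = tensor_sum m v \<psi>"
    using assms(1) by (rule tensorE) blast
  obtain n w \<phi> where w: "\<And>k. k < n \<Longrightarrow> w k \<in> L2 \<Omega>" "\<And>k. k < n \<Longrightarrow> \<phi> k \<in> S_time \<tau> N p"
      "W = tensor_sum n w \<phi>"
    using assms(2) by (rule tensorE) blast
  have pp: "\<psi> k \<in> piecewise_poly" "deriv (\<psi> k) \<in> piecewise_poly" if "k < m" for k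
    using v(2)[OF that] S_time_piecewise_poly dS_time_piecewise_poly deriv_S_time by blast+
  have pp': "\<phi> k \<in> piecewise_poly" "deriv (\<phi> k) \<in> piecewise_poly" if "k < n" for k
    using w(2)[OF that] S_time_piecewise_poly dS_time_piecewise_poly deriv_S_time by blast+
  have "QT_inner \<Omega> T (dt V) W = QT_inner \<Omega> T (tensor_sum m v (\<lambda>k. deriv (\<psi> k))) W"
    unfolding v(3) QT_inner_commute[of _ _ _ W] by (intro QT_inner_cong dt_tensor_sum[where p = p] v(2))
  also have "\<dots> = (\<Sum>k<m. \<Sum>l<n. L2_inner \<Omega> (v k) (w l) * (LINT t|time. deriv (\<psi> k) t * \<phi> l t))"
    unfolding w(3) by (intro slice_inner_tensor_sums v w pp pp')
  finally have 1: "QT_inner \<Omega> T (dt V) W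
      = (\<Sum>k<m. \<Sum>l<n. L2_inner \<Omega> (v k) (w l) * (LINT t|time. deriv (\<psi> k) t * \<phi> l t))" .
  have "QT_inner \<Omega> T V (dt W) = QT_inner \<Omega> T V (tensor_sum n w (\<lambda>k. deriv (\<phi> k)))"
    unfolding w(3) by (intro QT_inner_cong dt_tensor_sum[where p = p] w(2))
  also have "\<dots> = (\<Sum>k<m. \<Sum>l<n. L2_inner \<Omega> (v k) (w l) * (LINT t|time. \<psi> k t * deriv (\<phi> l) t))"
    unfolding v(3) by (intro slice_inner_tensor_sums v w pp pp')
  finally have "QT_inner \<Omega> T (dt V) W + QT_inner \<Omega> T V (dt W)
      = (\<Sum>k<m. \<Sum>l<n. L2_inner \<Omega> (v k) (w l) *
          ((LINT t|time. deriv (\<psi> k) t * \<phi> l t) + (LINT t|time. \<psi> k t * deriv (\<phi> l) t)))"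
    by (simp add: 1 distrib_left flip: sum.distrib)
  also have "\<dots> = (\<Sum>k<m. \<Sum>l<n. L2_inner \<Omega> (v k) (w l) * (\<psi> k T * \<phi> l T - \<psi> k 0 * \<phi> l 0))"
    by (intro sum.cong refl) (simp add: integration_by_parts_S_time[OF v(2) w(2)])
  also have "\<dots> = L2_inner \<Omega> (\<lambda>x. V x T) (\<lambda>x. W x T) - L2_inner \<Omega> (\<lambda>x. V x 0) (\<lambda>x. W x 0)"
    unfolding v(3) w(3) using v(1) w(1) by (simp add: L2_inner_tensor_sums) (simp add: right_diff_distrib sum_subtractf)
  finally show ?thesis .
qed

section \<open>The projection in time for space-time functions\<close>

text \<open>Both the pairing and the time derivative act on the time factors separately, so the projection
  may be taken in each of them.\<close>

lemma is_time_projection_tensor_sum: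
  assumes v: "\<And>k. k < m \<Longrightarrow> v k \<in> L2 \<Omega>" and \<psi>: "\<And>k. k < m \<Longrightarrow> \<psi> k \<in> S_time \<tau> N p"
    and \<xi>: "\<And>k. k < m \<Longrightarrow> \<xi> k \<in> dS_time \<tau> N p" and eq: "\<And>k. k < m \<Longrightarrow> same_moments p (\<psi> k) (\<xi> k)"
  shows "is_time_projection \<Omega> T \<tau> N p (tensor_sum m v \<psi>) (tensor_sum m v \<xi>)"
  unfolding is_time_projection_def
proof (intro conjI ballI)
  show "tensor_sum m v \<xi> \<in> tensor (L2 \<Omega>) (dS_time \<tau> N p)" by (intro tensorI v \<xi>)
next
  fix W assume "W \<in> tensor (L2 \<Omega>) (S_time \<tau> N p)"
  then obtain n w \<phi> where w: "\<And>l. l < n \<Longrightarrow> w l \<in> L2 \<Omega>" and \<phi>: "\<And>l. l < n \<Longrightarrow> \<phi> l \<in> S_time \<tau> N p"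
      and W: "W = tensor_sum n w \<phi>"
    by (rule tensorE) blast
  have dt: "QT_inner \<Omega> T U (dt W) = QT_inner \<Omega> T U (tensor_sum n w (\<lambda>l. deriv (\<phi> l)))" for U
    unfolding W by (intro QT_inner_cong dt_tensor_sum[where p = p] \<phi>)
  show "QT_inner \<Omega> T (tensor_sum m v \<xi>) (dt W) = QT_inner \<Omega> T (tensor_sum m v \<psi>) (dt W)"
    unfolding dt
    using v w S_time_piecewise_poly[OF \<psi>] dS_time_piecewise_poly[OF \<xi>]
      dS_time_piecewise_poly[OF deriv_S_time[OF \<phi>]] eq deriv_S_time[OF \<phi>]
    by (simp add: slice_inner_tensor_sums(2) same_moments_def)
qed

lemma is_time_projection_test:
  assumes P: "is_time_projection \<Omega> T \<tau> N p U P" and \<eta>: "\<eta> \<in> tensor (L2 \<Omega>) (dS_time \<tau> N p)"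
  shows "QT_inner \<Omega> T P \<eta> = QT_inner \<Omega> T U \<eta>"
proof -
  obtain W where W: "W \<in> tensor (L2 \<Omega>) (S_time \<tau> N p)" "QT_eq \<Omega> T (dt W) \<eta>"
    using dS_tensor_is_dt[OF \<eta>] by blast
  then have "QT_inner \<Omega> T P (dt W) = QT_inner \<Omega> T U (dt W)" using P by (auto simp: is_time_projection_def)
  then show ?thesis using QT_inner_cong[OF W(2)] by metis
qed

text \<open>The difference \<open>D\<close> of two projections is itself an admissible test function, so \<open>(D, D) = 0\<close>.\<close>

lemma is_time_projection_unique:
  assumes "is_time_projection \<Omega> T \<tau> N p U P" "is_time_projection \<Omega> T \<tau> N p U Q"
  shows "QT_eq \<Omega> T P Q"
proof -
  have PQ: "P \<in> tensor (L2 \<Omega>) (dS_time \<tau> N p)" "Q \<in> tensor (L2 \<Omega>) (dS_time \<tau> N p)"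
    using assms by (auto simp: is_time_projection_def)
  let ?D = "\<lambda>x t. P x t - Q x t"
  have D: "?D \<in> tensor (L2 \<Omega>) (dS_time \<tau> N p)"
    by (rule tensor_diff[OF _ PQ]) (use L2_scale[of _ \<Omega> "-1"] in auto)
  have sub: "X \<in> tensor (L2 \<Omega>) piecewise_poly" if "X \<in> tensor (L2 \<Omega>) (dS_time \<tau> N p)" for X
    using tensor_mono[of "L2 \<Omega>" "L2 \<Omega>" "dS_time \<tau> N p" piecewise_poly] dS_time_piecewise_poly that by blast
  have "QT_inner \<Omega> T ?D ?D = QT_inner \<Omega> T P ?D - QT_inner \<Omega> T Q ?D"
    by (intro QT_inner_diff_left sub PQ D)
  also have "\<dots> = 0"
    using is_time_projection_test[OF assms(1) D] is_time_projection_test[OF assms(2) D] by simp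
  finally show ?thesis by (intro QT_eq_if_QT_inner_diff_self_0 sub PQ)
qed

lemma time_projection_eq:
  assumes "is_time_projection \<Omega> T \<tau> N p U P"
  shows "QT_eq \<Omega> T (time_projection \<Omega> T \<tau> N p U) P"
  unfolding time_projection_def by (rule is_time_projection_unique[OF someI[of _ P] assms]) (rule assms)

lemma exists_time_projection:
  assumes A: "A \<subseteq> L2 \<Omega>" and W: "W \<in> tensor A (S_time \<tau> N p)"
  shows "\<exists>Q\<in>tensor A (dS_time \<tau> N p). is_time_projection \<Omega> T \<tau> N p W Q"
  using W
proof (rule tensorE)
  fix m v \<psi> assume v: "\<And>k. k < m \<Longrightarrow> v k \<in> A" and \<psi>: "\<And>k. k < m \<Longrightarrow> \<psi> k \<in> S_time \<tau> N p"
    and W: "W = tensor_sum m v \<psi>"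
  obtain \<xi> where \<xi>: "\<And>k. k < m \<Longrightarrow> \<xi> k \<in> dS_time \<tau> N p" "\<And>k. k < m \<Longrightarrow> same_moments p (\<psi> k) (\<xi> k)"
    using exists_S_time_projection[OF \<psi>] by metis
  have "is_time_projection \<Omega> T \<tau> N p (tensor_sum m v \<psi>) (tensor_sum m v \<xi>)"
    by (rule is_time_projection_tensor_sum) (use v \<psi> \<xi> A in auto)
  then show ?thesis using tensorI[of m v A \<xi>] v \<xi>(1) unfolding W by blast
qed

lemma exists_projection_preimage_end0:
  assumes A: "A \<subseteq> L2 \<Omega>" and \<Lambda>: "\<Lambda> \<in> tensor A (dS_time \<tau> N p)"
  shows "\<exists>W\<in>tensor A (S_time_end0 \<tau> N p). is_time_projection \<Omega> T \<tau> N p W \<Lambda>"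
  using \<Lambda>
proof (rule tensorE)
  fix m v \<xi> assume v: "\<And>k. k < m \<Longrightarrow> v k \<in> A" and \<xi>: "\<And>k. k < m \<Longrightarrow> \<xi> k \<in> dS_time \<tau> N p"
    and \<Lambda>: "\<Lambda> = tensor_sum m v \<xi>"
  have "\<exists>\<psi>. \<psi> \<in> S_time \<tau> N p \<and> \<psi> (\<tau> N) = 0 \<and> same_moments p \<psi> (\<xi> k)" if "k < m" for k
    using exists_S_time_preimage[OF \<xi>[OF that], of False 0] by auto
  then obtain \<psi> where \<psi>: "\<And>k. k < m \<Longrightarrow> \<psi> k \<in> S_time \<tau> N p" "\<And>k. k < m \<Longrightarrow> \<psi> k (\<tau> N) = 0"
      "\<And>k. k < m \<Longrightarrow> same_moments p (\<psi> k) (\<xi> k)"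
    by metis
  have "is_time_projection \<Omega> T \<tau> N p (tensor_sum m v \<psi>) (tensor_sum m v \<xi>)"
    by (rule is_time_projection_tensor_sum) (use v \<psi> \<xi> A in auto)
  moreover have "tensor_sum m v \<psi> \<in> tensor A (S_time_end0 \<tau> N p)"
    by (rule tensorI) (use v \<psi> in \<open>auto simp: S_time_end0_def\<close>)
  ultimately show ?thesis unfolding \<Lambda> by blast
qed

text \<open>The summands of \<open>V\<close> that project to those of \<open>\<eta>\<close> are made to vanish at \<open>0\<close>.  One more summand \<open>V0 \<otimes> \<psi>\<close>
  with \<open>\<psi>(0) = 1\<close> and projection \<open>0\<close> carries the initial value.\<close>

lemma exists_velocity:
  assumes A: "A \<subseteq> L2 \<Omega>" and V0: "V0 \<in> A" and \<eta>: "\<eta> \<in> tensor A (dS_time \<tau> N p)"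
  shows "\<exists>V\<in>tensor A (S_time \<tau> N p). is_time_projection \<Omega> T \<tau> N p V \<eta> \<and> (\<forall>x. V x 0 = V0 x)"
  using \<eta>
proof (rule tensorE)
  fix m v \<xi> assume v: "\<And>k. k < m \<Longrightarrow> v k \<in> A" and \<xi>: "\<And>k. k < m \<Longrightarrow> \<xi> k \<in> dS_time \<tau> N p"
    and \<eta>: "\<eta> = tensor_sum m v \<xi>"
  define v' where "v' = v(m := V0)"
  define \<xi>' where "\<xi>' = \<xi>(m := (\<lambda>t. 0))"
  have "(\<lambda>t. 0) \<in> dS_time \<tau> N p"
    unfolding dS_time_iff by (auto simp: deg_less_def intro!: exI[of _ 0])
  then have \<xi>': "\<xi>' k \<in> dS_time \<tau> N p" if "k < Suc m" for k
    using \<xi> that by (auto simp: \<xi>'_def less_Suc_eq)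
  have "\<exists>\<psi>. \<psi> \<in> S_time \<tau> N p \<and> \<psi> 0 = (if k = m then 1 else 0) \<and> same_moments p \<psi> (\<xi>' k)" if "k < Suc m" for k
    using exists_S_time_preimage[OF \<xi>'[OF that], of True "if k = m then 1 else 0"] node_0 by auto
  then obtain \<psi> where \<psi>: "\<And>k. k < Suc m \<Longrightarrow> \<psi> k \<in> S_time \<tau> N p"
      "\<And>k. k < Suc m \<Longrightarrow> \<psi> k 0 = (if k = m then 1 else 0)"
      "\<And>k. k < Suc m \<Longrightarrow> same_moments p (\<psi> k) (\<xi>' k)"
    by metis
  have v': "v' k \<in> A" if "k < Suc m" for k using v V0 that by (auto simp: v'_def less_Suc_eq)
  have "is_time_projection \<Omega> T \<tau> N p (tensor_sum (Suc m) v' \<psi>) (tensor_sum (Suc m) v' \<xi>')"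
    by (rule is_time_projection_tensor_sum) (use v' \<psi> \<xi>' A in auto)
  moreover have "tensor_sum (Suc m) v' \<xi>' = \<eta>"
    by (simp add: \<eta> v'_def \<xi>'_def tensor_sum_def)
  moreover have "tensor_sum (Suc m) v' \<psi> x 0 = V0 x" for x
    by (simp add: \<psi>(2) v'_def tensor_sum_def)
  ultimately show ?thesis using tensorI[of "Suc m" v' A \<psi>] v' \<psi>(1) by metis
qed

end

section \<open>Equivalence of the two schemes\<close>

lemma S_subset_L2: "S \<subseteq> piecewise_polynomial_H10 \<Omega> \<K> p \<Longrightarrow> S \<subseteq> L2 \<Omega>"
  by (auto simp: piecewise_polynomial_H10_def H10_def H1_def)

context space_time_mesh
begin

context
  fixes S :: "(real^'n \<Rightarrow> real) set"
  assumes S: "S \<subseteq> L2 \<Omega>"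
begin

lemma tensor_S_time_L2: "W \<in> tensor S (S_time \<tau> N p) \<Longrightarrow> W \<in> tensor (L2 \<Omega>) (S_time \<tau> N p)"
  and tensor_dS_time_L2: "W \<in> tensor S (dS_time \<tau> N p) \<Longrightarrow> W \<in> tensor (L2 \<Omega>) (dS_time \<tau> N p)"
  and tensor_end0: "W \<in> tensor S (S_time_end0 \<tau> N p) \<Longrightarrow> W \<in> tensor S (S_time \<tau> N p)"
  using tensor_mono[OF S order_refl] tensor_mono[OF order_refl, of "S_time_end0 \<tau> N p" "S_time \<tau> N p" S]
  by (auto simp: S_time_end0_def)

lemma tensor_end0_final: "W \<in> tensor S (S_time_end0 \<tau> N p) \<Longrightarrow> W x T = 0"
  by (elim tensorE) (simp add: tensor_sum_def S_time_end0_def node_N)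

lemma L2_inner_cong_domain:
  fixes f :: "real^'n \<Rightarrow> real"
  assumes "\<And>x. x \<in> \<Omega> \<Longrightarrow> f x = g x"
  shows "L2_inner \<Omega> f h = L2_inner \<Omega> g h"
  unfolding L2_inner_def by (rule Bochner_Integration.integral_cong) (use assms in auto)

text \<open>The identity that links the schemes.  Replacing \<open>\<Lambda>\<close> by \<open>W\<close> is allowed because \<open>\<partial>\<^sub>tV\<close> lies in the range
  of the projection; the rest is integration by parts.\<close>

lemma velocity_inner_projection:
  assumes V: "V \<in> tensor S (S_time \<tau> N p)" "\<forall>x\<in>\<Omega>. V x 0 = V0 x"
    and W: "W \<in> tensor S (S_time_end0 \<tau> N p)" "is_time_projection \<Omega> T \<tau> N p W \<Lambda>"
  shows "QT_inner \<Omega> T (dt V) \<Lambda> = - QT_inner \<Omega> T V (dt W) - L2_inner \<Omega> V0 (\<lambda>x. W x 0)"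
proof -
  have V': "V \<in> tensor (L2 \<Omega>) (S_time \<tau> N p)" and W': "W \<in> tensor (L2 \<Omega>) (S_time \<tau> N p)"
    using V(1) W(1) tensor_S_time_L2 tensor_end0 by blast+
  have "QT_inner \<Omega> T (dt V) \<Lambda> = QT_inner \<Omega> T (dt V) W"
    using W(2) V' unfolding is_time_projection_def by (metis QT_inner_commute)
  moreover have "QT_inner \<Omega> T (dt V) W + QT_inner \<Omega> T V (dt W)
      = L2_inner \<Omega> (\<lambda>x. V x T) (\<lambda>x. W x T) - L2_inner \<Omega> (\<lambda>x. V x 0) (\<lambda>x. W x 0)"
    by (rule integration_by_parts_tensor[OF V' W'])
  moreover have "L2_inner \<Omega> (\<lambda>x. V x T) (\<lambda>x. W x T) = 0"
    by (simp add: tensor_end0_final[OF W(1)] L2_inner_def)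
  moreover have "L2_inner \<Omega> (\<lambda>x. V x 0) (\<lambda>x. W x 0) = L2_inner \<Omega> V0 (\<lambda>x. W x 0)"
    by (rule L2_inner_cong_domain) (use V(2) in auto)
  ultimately show ?thesis by linarith
qed

lemma first_order_imp_second_order:
  assumes "first_order_solution \<Omega> T c F S \<tau> N p U0 V0 U V"
  shows "second_order_solution \<Omega> T c F S \<tau> N p U0 V0 U"
proof -
  have U: "U \<in> tensor S (S_time \<tau> N p)" "\<forall>x\<in>\<Omega>. U x 0 = U0 x"
    and V: "V \<in> tensor S (S_time \<tau> N p)" "\<forall>x\<in>\<Omega>. V x 0 = V0 x"
    and eq1: "\<And>\<xi>. \<xi> \<in> tensor S (dS_time \<tau> N p) \<Longrightarrow> QT_inner \<Omega> T (dt U) \<xi> = QT_inner \<Omega> T V \<xi>"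
    and eq2: "\<And>\<Lambda>. \<Lambda> \<in> tensor S (dS_time \<tau> N p) \<Longrightarrow>
        QT_inner \<Omega> T (dt V) \<Lambda> + stiffness \<Omega> T c U \<Lambda> = QT_inner \<Omega> T F \<Lambda>"
    using assms by (auto simp: first_order_solution_def)
  have "- QT_inner \<Omega> T (dt U) (dt W) + stiffness \<Omega> T c U (time_projection \<Omega> T \<tau> N p W)
      = QT_inner \<Omega> T F (time_projection \<Omega> T \<tau> N p W) + L2_inner \<Omega> V0 (\<lambda>x. W x 0)"
    if W: "W \<in> tensor S (S_time_end0 \<tau> N p)" for W
  proof -
    obtain \<Lambda> where \<Lambda>: "\<Lambda> \<in> tensor S (dS_time \<tau> N p)" "is_time_projection \<Omega> T \<tau> N p W \<Lambda>"
      using exists_time_projection[OF S tensor_end0[OF W]] by blast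
    obtain \<eta> where \<eta>: "\<eta> \<in> tensor S (dS_time \<tau> N p)" "QT_eq \<Omega> T (dt W) \<eta>"
      using dt_tensor[OF tensor_end0[OF W]] by blast
    have "QT_inner \<Omega> T (dt U) (dt W) = QT_inner \<Omega> T V (dt W)"
      using eq1[OF \<eta>(1)] by (simp add: QT_inner_cong[OF \<eta>(2)])
    moreover have "QT_inner \<Omega> T (dt V) \<Lambda> = - QT_inner \<Omega> T V (dt W) - L2_inner \<Omega> V0 (\<lambda>x. W x 0)"
      by (rule velocity_inner_projection[OF V W \<Lambda>(2)])
    ultimately show ?thesis
      using eq2[OF \<Lambda>(1)] time_projection_eq[OF \<Lambda>(2)]
      by (simp add: QT_inner_cong[of "time_projection \<Omega> T \<tau> N p W" \<Lambda>]
          stiffness_cong[of "time_projection \<Omega> T \<tau> N p W" \<Lambda>])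
  qed
  then show ?thesis using U by (simp add: second_order_solution_def)
qed

text \<open>The first equation restates that \<open>V\<close> projects to \<open>\<partial>\<^sub>tU\<close>.  For the second one, the given test
  function \<open>\<Lambda>\<close> is written as the projection of a test function \<open>W\<close> of the second-order scheme.\<close>

lemma second_order_imp_first_order:
  assumes sol: "second_order_solution \<Omega> T c F S \<tau> N p U0 V0 U"
    and V: "V \<in> tensor S (S_time \<tau> N p)" "\<forall>x\<in>\<Omega>. V x 0 = V0 x"
    and proj: "QT_eq \<Omega> T (time_projection \<Omega> T \<tau> N p V) (dt U)"
  shows "first_order_solution \<Omega> T c F S \<tau> N p U0 V0 U V"
proof -
  have U: "U \<in> tensor S (S_time \<tau> N p)" "\<forall>x\<in>\<Omega>. U x 0 = U0 x"
    and eq: "\<And>W. W \<in> tensor S (S_time_end0 \<tau> N p) \<Longrightarrow>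
        - QT_inner \<Omega> T (dt U) (dt W) + stiffness \<Omega> T c U (time_projection \<Omega> T \<tau> N p W)
        = QT_inner \<Omega> T F (time_projection \<Omega> T \<tau> N p W) + L2_inner \<Omega> V0 (\<lambda>x. W x 0)"
    using sol by (auto simp: second_order_solution_def)
  obtain P where P: "is_time_projection \<Omega> T \<tau> N p V P"
    using exists_time_projection[OF S V(1)] by blast
  have PU: "QT_eq \<Omega> T P (dt U)"
    using QT_eq_trans[OF QT_eq_sym[OF time_projection_eq[OF P]] proj] .
  have test: "QT_inner \<Omega> T (dt U) \<xi> = QT_inner \<Omega> T V \<xi>" if "\<xi> \<in> tensor (L2 \<Omega>) (dS_time \<tau> N p)" for \<xi>
    using is_time_projection_test[OF P that] QT_inner_cong[OF PU, of \<xi>] by (simp add: QT_inner_commute)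
  have eq2: "QT_inner \<Omega> T (dt V) \<Lambda> + stiffness \<Omega> T c U \<Lambda> = QT_inner \<Omega> T F \<Lambda>"
    if \<Lambda>: "\<Lambda> \<in> tensor S (dS_time \<tau> N p)" for \<Lambda>
  proof -
    obtain W where W: "W \<in> tensor S (S_time_end0 \<tau> N p)" "is_time_projection \<Omega> T \<tau> N p W \<Lambda>"
      using exists_projection_preimage_end0[OF S \<Lambda>] by blast
    obtain \<eta> where \<eta>: "\<eta> \<in> tensor S (dS_time \<tau> N p)" "QT_eq \<Omega> T (dt W) \<eta>"
      using dt_tensor[OF tensor_end0[OF W(1)]] by blast
    have "QT_inner \<Omega> T (dt U) (dt W) = QT_inner \<Omega> T V (dt W)"
      using test[OF tensor_dS_time_L2[OF \<eta>(1)]] by (simp add: QT_inner_cong[OF \<eta>(2)])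
    moreover have "QT_inner \<Omega> T (dt V) \<Lambda> = - QT_inner \<Omega> T V (dt W) - L2_inner \<Omega> V0 (\<lambda>x. W x 0)"
      by (rule velocity_inner_projection[OF V W])
    ultimately show ?thesis
      using eq[OF W(1)] time_projection_eq[OF W(2)]
      by (simp add: QT_inner_cong[of "time_projection \<Omega> T \<tau> N p W" \<Lambda>]
          stiffness_cong[of "time_projection \<Omega> T \<tau> N p W" \<Lambda>])
  qed
  then show ?thesis
    using U V test tensor_dS_time_L2 by (simp add: first_order_solution_def)
qed

lemma exists_velocity_of_dt:
  assumes U: "U \<in> tensor S (S_time \<tau> N p)" and V0: "V0 \<in> S"
  shows "\<exists>V\<in>tensor S (S_time \<tau> N p).
      QT_eq \<Omega> T (time_projection \<Omega> T \<tau> N p V) (dt U) \<and> (\<forall>x. V x 0 = V0 x)"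
proof -
  obtain \<eta> where \<eta>: "\<eta> \<in> tensor S (dS_time \<tau> N p)" "QT_eq \<Omega> T (dt U) \<eta>"
    using dt_tensor[OF U] by blast
  obtain V where "V \<in> tensor S (S_time \<tau> N p)" "is_time_projection \<Omega> T \<tau> N p V \<eta>" "\<forall>x. V x 0 = V0 x"
    using exists_velocity[OF S V0 \<eta>(1)] by blast
  then show ?thesis
    using QT_eq_trans[OF time_projection_eq QT_eq_sym[OF \<eta>(2)]] by blast
qed

end

end

theorem theorem2p5:
  fixes \<Omega> :: "(real^'n) set" and T c\<^sub>0 h\<^sub>x \<sigma> :: real
    and c U\<^sub>0 V\<^sub>0 U\<^sub>0\<^sub>h V\<^sub>0\<^sub>h :: "real^'n \<Rightarrow> real"
    and F :: "real^'n \<Rightarrow> real \<Rightarrow> real"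
    and \<K> :: "(real^'n) set set" and S :: "(real^'n \<Rightarrow> real) set"
    and \<tau> :: "nat \<Rightarrow> real" and N p\<^sub>x p\<^sub>t :: nat
  assumes dim: "CARD('n) \<in> {1, 2, 3}"
    and domain: "lipschitz_domain \<Omega>" "polytopal \<Omega>"
    and T: "T > 0"
    and c: "continuous_on (closure \<Omega>) c" "c\<^sub>0 > 0" "\<And>x. x \<in> \<Omega> \<Longrightarrow> c x \<ge> c\<^sub>0"
    and data: "U\<^sub>0 \<in> H10 \<Omega>" "V\<^sub>0 \<in> L2 \<Omega>" "F \<in> L1_L2 \<Omega> T"
    and mesh: "simplicial_mesh \<Omega> \<K>" "shape_regular \<sigma> \<K>" "h\<^sub>x = mesh_size \<K>"
    and S: "p\<^sub>x \<ge> 1" "linear_function_space S" "S \<subseteq> piecewise_polynomial_H10 \<Omega> \<K> p\<^sub>x"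
    and time: "time_partition \<tau> N T" "p\<^sub>t \<ge> 1"
    and U0h: "U\<^sub>0\<^sub>h \<in> S"
      "\<And>W. W \<in> S \<Longrightarrow> L2_inner \<Omega> (\<lambda>x. (c x)\<^sup>2 *\<^sub>R grad \<Omega> U\<^sub>0\<^sub>h x) (grad \<Omega> W)
                     = L2_inner \<Omega> (\<lambda>x. (c x)\<^sup>2 *\<^sub>R grad \<Omega> U\<^sub>0 x) (grad \<Omega> W)"
    and V0h: "V\<^sub>0\<^sub>h \<in> S"
      "\<And>W. W \<in> S \<Longrightarrow> L2_inner \<Omega> V\<^sub>0\<^sub>h W = L2_inner \<Omega> V\<^sub>0 W"
  shows
    "(\<forall>U V. first_order_solution \<Omega> T c F S \<tau> N p\<^sub>t U\<^sub>0\<^sub>h V\<^sub>0\<^sub>h U V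
            \<longrightarrow> second_order_solution \<Omega> T c F S \<tau> N p\<^sub>t U\<^sub>0\<^sub>h V\<^sub>0\<^sub>h U) \<and>
     (\<forall>U. second_order_solution \<Omega> T c F S \<tau> N p\<^sub>t U\<^sub>0\<^sub>h V\<^sub>0\<^sub>h U \<longrightarrow>
        (\<exists>V\<in>tensor S (S_time \<tau> N p\<^sub>t).
           QT_eq \<Omega> T (time_projection \<Omega> T \<tau> N p\<^sub>t V) (dt U) \<and> (\<forall>x\<in>\<Omega>. V x 0 = V\<^sub>0\<^sub>h x)) \<and>
        (\<forall>V\<in>tensor S (S_time \<tau> N p\<^sub>t).
           QT_eq \<Omega> T (time_projection \<Omega> T \<tau> N p\<^sub>t V) (dt U) \<and> (\<forall>x\<in>\<Omega>. V x 0 = V\<^sub>0\<^sub>h x)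
           \<longrightarrow> first_order_solution \<Omega> T c F S \<tau> N p\<^sub>t U\<^sub>0\<^sub>h V\<^sub>0\<^sub>h U V))"
proof -
  have "\<Omega> \<in> sets lebesgue"
    using domain(1) by (simp add: lipschitz_domain_def lmeasurable_open fmeasurableD)
  then interpret space_time_mesh \<tau> N T \<Omega>
    by unfold_locales (rule time(1))
  have S2: "S \<subseteq> L2 \<Omega>" by (rule S_subset_L2[OF S(3)])
  show ?thesis
  proof (intro conjI allI impI)
    fix U V assume "first_order_solution \<Omega> T c F S \<tau> N p\<^sub>t U\<^sub>0\<^sub>h V\<^sub>0\<^sub>h U V"
    then show "second_order_solution \<Omega> T c F S \<tau> N p\<^sub>t U\<^sub>0\<^sub>h V\<^sub>0\<^sub>h U"
      by (rule first_order_imp_second_order[OF S2])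
  next
    fix U assume U: "second_order_solution \<Omega> T c F S \<tau> N p\<^sub>t U\<^sub>0\<^sub>h V\<^sub>0\<^sub>h U"
    show "\<exists>V\<in>tensor S (S_time \<tau> N p\<^sub>t).
        QT_eq \<Omega> T (time_projection \<Omega> T \<tau> N p\<^sub>t V) (dt U) \<and> (\<forall>x\<in>\<Omega>. V x 0 = V\<^sub>0\<^sub>h x)"
      using exists_velocity_of_dt[OF S2 _ V0h(1)] U unfolding second_order_solution_def by blast
    show "\<forall>V\<in>tensor S (S_time \<tau> N p\<^sub>t).
        QT_eq \<Omega> T (time_projection \<Omega> T \<tau> N p\<^sub>t V) (dt U) \<and> (\<forall>x\<in>\<Omega>. V x 0 = V\<^sub>0\<^sub>h x)
        \<longrightarrow> first_order_solution \<Omega> T c F S \<tau> N p\<^sub>t U\<^sub>0\<^sub>h V\<^sub>0\<^sub>h U V"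
      using second_order_imp_first_order[OF S2 U] by blast
  qed
qed

end
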